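(* Let $M$ be a compact smooth manifold of dimension $2n$. Suppose there exists a smooth solution $(\omega(t),J(t))$, by almost Hermitian structures, of the $d^*d$-Ricci flow $$\frac{\partial\omega}{\partial t}+d^*d\,\omega=0,\qquad \frac{\partial J}{\partial t}=K_1(\omega,J)+B(\omega,J),$$ and that the initial data is symplectic, $d\omega_0=0$. Then $\omega=\omega_0$ along the flow and the flow is reduced to $$\frac{\partial J}{\partial t}=B(\omega_0,J).$$
   Context: An almost Hermitian structure is a pair $(\omega,J)$ of a $2$-form and an almost complex structure with $g(\cdot,\cdot)=\omega(\cdot,J\cdot)$ symmetric and positive definite. $d^*$ is the formal $L^2$-adjoint of $d$ with respect to $g$, and $Ric$ is the Ricci tensor of $g$. The endomorphisms $K_1(\omega,J)$ and $B(\omega,J)$ of $TM$ are determined by $$g(K_1x,y)=\frac12\left(d^*d\,\omega(Jx,Jy)-d^*d\,\omega(x,y)\right),\qquad g(Bx,y)=Ric(Jx,y)+Ric(x,Jy).$$ *)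

theory Defs
  imports "HOL-Analysis.Analysis"
begin

section \<open>Smooth maps\<close>

text \<open>Derivatives are taken within the domain \<open>S\<close>. For open \<open>S\<close> this is the usual notion of
  \<open>C\<^sup>k\<close> map; for \<open>S\<close> the product of a nondegenerate interval and an open set, where derivatives
  within \<open>S\<close> are still unique, it is the usual notion with one-sided time derivatives at the
  endpoints of the interval.\<close>

fun Ck_on :: "nat \<Rightarrow> 'a::real_normed_vector set \<Rightarrow> ('a \<Rightarrow> 'b::real_normed_vector) \<Rightarrow> bool" where
  "Ck_on 0 S f \<longleftrightarrow> continuous_on S f"
| "Ck_on (Suc k) S f \<longleftrightarrow> (\<forall>x\<in>S. f differentiable (at x within S)) \<and>
     (\<forall>v. Ck_on k S (\<lambda>x. frechet_derivative f (at x within S) v))"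

definition smooth_on :: "'a::real_normed_vector set \<Rightarrow> ('a \<Rightarrow> 'b::real_normed_vector) \<Rightarrow> bool" where
  "smooth_on S f \<longleftrightarrow> (\<forall>k. Ck_on k S f)"


section \<open>Smooth manifolds\<close>

text \<open>The underlying space of the manifold is the type \<open>'m\<close>. A chart is a pair of its domain and
  its coordinate map.\<close>

type_synonym ('m, 'k) chart = "'m set \<times> ('m \<Rightarrow> real^'k)"

abbreviation chart_dom :: "('m, 'k) chart \<Rightarrow> 'm set" where "chart_dom \<equiv> fst"
abbreviation crd :: "('m, 'k) chart \<Rightarrow> 'm \<Rightarrow> real^'k" where "crd \<equiv> snd"

definition inv_crd :: "('m, 'k) chart \<Rightarrow> real^'k \<Rightarrow> 'm" where
  "inv_crd c = the_inv_into (chart_dom c) (crd c)"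

definition is_chart :: "('m::topological_space, 'k::finite) chart \<Rightarrow> bool" where
  "is_chart c \<longleftrightarrow> open (chart_dom c) \<and> open (crd c ` chart_dom c) \<and>
     homeomorphism (chart_dom c) (crd c ` chart_dom c) (crd c) (inv_crd c)"

definition smooth_atlas :: "('m::topological_space, 'k::finite) chart set \<Rightarrow> bool" where
  "smooth_atlas A \<longleftrightarrow> (\<forall>c\<in>A. is_chart c) \<and> (\<Union>c\<in>A. chart_dom c) = UNIV \<and>
     (\<forall>c\<in>A. \<forall>c'\<in>A. smooth_on (crd c ` (chart_dom c \<inter> chart_dom c')) (\<lambda>x. crd c' (inv_crd c x)))"

definition jac :: "('m, 'k::finite) chart \<Rightarrow> ('m, 'k) chart \<Rightarrow> 'm \<Rightarrow> real^'k^'k" where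
  "jac c c' p = matrix (frechet_derivative (\<lambda>x. crd c' (inv_crd c x)) (at (crd c p)))"

definition pderiv :: "('m, 'k::finite) chart \<Rightarrow> 'k \<Rightarrow> ('m \<Rightarrow> real) \<Rightarrow> 'm \<Rightarrow> real" where
  "pderiv c i f p = frechet_derivative (\<lambda>x. f (inv_crd c x)) (at (crd c p)) (axis i 1)"


section \<open>Tensor fields\<close>

text \<open>A tensor field is given by its components: \<open>\<alpha> c p\<close> is the array of components of the tensor
  at the point \<open>p\<close> in the chart \<open>c\<close>, for charts \<open>c\<close> of the atlas and \<open>p \<in> chart_dom c\<close>; the components in
  different charts are related by the usual transformation laws. Values of \<open>\<alpha> c p\<close> for other \<open>c\<close>
  and \<open>p\<close> carry no meaning. A bilinear form with matrix \<open>a\<close> has components \<open>a $ i $ j\<close> and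
  an endomorphism with matrix \<open>a\<close> maps \<open>x\<close> to \<open>a *v x\<close>.\<close>

type_synonym ('m, 'k) tensor2 = "('m, 'k) chart \<Rightarrow> 'm \<Rightarrow> real^'k^'k"
type_synonym ('m, 'k) tensor3 = "('m, 'k) chart \<Rightarrow> 'm \<Rightarrow> real^'k^'k^'k"

abbreviation bil :: "real^'k^'k \<Rightarrow> real^'k::finite \<Rightarrow> real^'k \<Rightarrow> real" where
  "bil a x y \<equiv> x \<bullet> (a *v y)"

definition smooth_tensor2 :: "('m::topological_space, 'k::finite) chart set \<Rightarrow> ('m, 'k) tensor2 \<Rightarrow> bool"
  where "smooth_tensor2 A \<alpha> \<longleftrightarrow> (\<forall>c\<in>A. smooth_on (crd c ` chart_dom c) (\<lambda>x. \<alpha> c (inv_crd c x)))"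

definition bilinear_form_field :: "('m, 'k::finite) chart set \<Rightarrow> ('m, 'k) tensor2 \<Rightarrow> bool" where
  "bilinear_form_field A \<alpha> \<longleftrightarrow> (\<forall>c\<in>A. \<forall>c'\<in>A. \<forall>p\<in>chart_dom c \<inter> chart_dom c'. \<forall>x y.
     bil (\<alpha> c p) x y = bil (\<alpha> c' p) (jac c c' p *v x) (jac c c' p *v y))"

definition endomorphism_field :: "('m, 'k::finite) chart set \<Rightarrow> ('m, 'k) tensor2 \<Rightarrow> bool" where
  "endomorphism_field A K \<longleftrightarrow> (\<forall>c\<in>A. \<forall>c'\<in>A. \<forall>p\<in>chart_dom c \<inter> chart_dom c'. \<forall>x.
     jac c c' p *v (K c p *v x) = K c' p *v (jac c c' p *v x))"

definition two_form :: "('m::topological_space, 'k::finite) chart set \<Rightarrow> ('m, 'k) tensor2 \<Rightarrow> bool" where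
  "two_form A \<alpha> \<longleftrightarrow> smooth_tensor2 A \<alpha> \<and> bilinear_form_field A \<alpha> \<and>
     (\<forall>c\<in>A. \<forall>p\<in>chart_dom c. \<forall>x y. bil (\<alpha> c p) x y = - bil (\<alpha> c p) y x)"

definition ext_deriv :: "('m, 'k::finite) tensor2 \<Rightarrow> ('m, 'k) tensor3" where
  "ext_deriv \<alpha> c p = (\<chi> i j k.
     pderiv c i (\<lambda>q. \<alpha> c q $ j $ k) p + pderiv c j (\<lambda>q. \<alpha> c q $ k $ i) p
     + pderiv c k (\<lambda>q. \<alpha> c q $ i $ j) p)"


section \<open>Almost Hermitian structures\<close>

definition almost_complex :: "('m::topological_space, 'k::finite) chart set \<Rightarrow> ('m, 'k) tensor2 \<Rightarrow> bool"
  where "almost_complex A J \<longleftrightarrow> smooth_tensor2 A J \<and> endomorphism_field A J \<and>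
     (\<forall>c\<in>A. \<forall>p\<in>chart_dom c. \<forall>x. J c p *v (J c p *v x) = - x)"

text \<open>The bilinear form \<open>g(x,y) = \<omega>(x,Jy)\<close>.\<close>

definition metric :: "('m, 'k::finite) tensor2 \<Rightarrow> ('m, 'k) tensor2 \<Rightarrow> ('m, 'k) tensor2" where
  "metric \<omega> J c p = \<omega> c p ** J c p"

definition almost_hermitian ::
  "('m::topological_space, 'k::finite) chart set \<Rightarrow> ('m, 'k) tensor2 \<Rightarrow> ('m, 'k) tensor2 \<Rightarrow> bool" where
  "almost_hermitian A \<omega> J \<longleftrightarrow> two_form A \<omega> \<and> almost_complex A J \<and>
     (\<forall>c\<in>A. \<forall>p\<in>chart_dom c.
        (\<forall>x y. bil (metric \<omega> J c p) x y = bil (metric \<omega> J c p) y x) \<and>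
        (\<forall>x. x \<noteq> 0 \<longrightarrow> bil (metric \<omega> J c p) x x > 0))"


section \<open>Ricci tensor\<close>

definition ginv :: "('m, 'k::finite) tensor2 \<Rightarrow> ('m, 'k) tensor2" where
  "ginv g c p = matrix_inv (g c p)"

text \<open>\<open>christoffel g c p l i j\<close> is the component along \<open>\<partial>\<^sub>l\<close> of \<open>\<nabla>\<^bsub>\<partial>\<^sub>i\<^esub> \<partial>\<^sub>j\<close>.\<close>

definition christoffel ::
  "('m, 'k::finite) tensor2 \<Rightarrow> ('m, 'k) chart \<Rightarrow> 'm \<Rightarrow> 'k \<Rightarrow> 'k \<Rightarrow> 'k \<Rightarrow> real" where
  "christoffel g c p l i j = (\<Sum>m\<in>UNIV. ginv g c p $ l $ m *
     (pderiv c i (\<lambda>q. g c q $ j $ m) p + pderiv c j (\<lambda>q. g c q $ i $ m) p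
      - pderiv c m (\<lambda>q. g c q $ i $ j) p)) / 2"

text \<open>\<open>riemann g c p l k i j\<close> is the component along \<open>\<partial>\<^sub>l\<close> of \<open>R(\<partial>\<^sub>i,\<partial>\<^sub>j)\<partial>\<^sub>k\<close>, where
  \<open>R(X,Y)Z = \<nabla>\<^sub>X\<nabla>\<^sub>Y Z - \<nabla>\<^sub>Y\<nabla>\<^sub>X Z - \<nabla>\<^bsub>[X,Y]\<^esub> Z\<close>.\<close>

definition riemann ::
  "('m, 'k::finite) tensor2 \<Rightarrow> ('m, 'k) chart \<Rightarrow> 'm \<Rightarrow> 'k \<Rightarrow> 'k \<Rightarrow> 'k \<Rightarrow> 'k \<Rightarrow> real" where
  "riemann g c p l k i j =
     pderiv c i (\<lambda>q. christoffel g c q l j k) p - pderiv c j (\<lambda>q. christoffel g c q l i k) p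
     + (\<Sum>m\<in>UNIV. christoffel g c p l i m * christoffel g c p m j k
                - christoffel g c p l j m * christoffel g c p m i k)"

text \<open>\<open>Ric(Y,Z)\<close> is the trace of \<open>X \<mapsto> R(X,Y)Z\<close>, so that round spheres have positive Ricci tensor.\<close>

definition ricci :: "('m, 'k::finite) tensor2 \<Rightarrow> ('m, 'k) tensor2" where
  "ricci g c p = (\<chi> j k. \<Sum>i\<in>UNIV. riemann g c p i k i j)"


section \<open>The $L^2$-adjoint of the exterior derivative\<close>

text \<open>Pointwise inner products of forms, normalised as usual so that the wedge products of the
  elements of an orthonormal coframe are orthonormal.\<close>

definition inner2 :: "('m, 'k::finite) tensor2 \<Rightarrow> ('m, 'k) tensor2 \<Rightarrow> ('m, 'k) tensor2
    \<Rightarrow> ('m, 'k) chart \<Rightarrow> 'm \<Rightarrow> real" where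
  "inner2 g \<alpha> \<beta> c p = (\<Sum>i\<in>UNIV. \<Sum>j\<in>UNIV. \<Sum>a\<in>UNIV. \<Sum>b\<in>UNIV.
     ginv g c p $ i $ a * ginv g c p $ j $ b * \<alpha> c p $ i $ j * \<beta> c p $ a $ b) / 2"

definition inner3 :: "('m, 'k::finite) tensor2 \<Rightarrow> ('m, 'k) tensor3 \<Rightarrow> ('m, 'k) tensor3
    \<Rightarrow> ('m, 'k) chart \<Rightarrow> 'm \<Rightarrow> real" where
  "inner3 g \<eta> \<theta> c p = (\<Sum>i\<in>UNIV. \<Sum>j\<in>UNIV. \<Sum>k\<in>UNIV. \<Sum>a\<in>UNIV. \<Sum>b\<in>UNIV. \<Sum>d\<in>UNIV.
     ginv g c p $ i $ a * ginv g c p $ j $ b * ginv g c p $ k $ d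
     * \<eta> c p $ i $ j $ k * \<theta> c p $ a $ b $ d) / 6"

text \<open>Integrals over the compact manifold are computed by cutting it into finitely many disjoint
  Borel pieces, each relatively compact in a chart domain, and integrating every piece in its chart
  against the Riemannian density \<open>\<surd>(det g)\<close>. Such a partition exists, and by the change of variables
  formula the value does not depend on it when \<open>f\<close> is a continuous function, that is, when the
  value \<open>f c p\<close> does not depend on the chart \<open>c\<close> and is continuous in \<open>p\<close>.\<close>

definition chart_partition :: "('m::topological_space, 'k::finite) chart set
    \<Rightarrow> ('m, 'k) chart set \<Rightarrow> (('m, 'k) chart \<Rightarrow> 'm set) \<Rightarrow> bool" where
  "chart_partition A F E \<longleftrightarrow> finite F \<and> F \<subseteq> A \<and>
     (\<forall>c\<in>F. E c \<in> sets borel \<and> (\<exists>K. compact K \<and> E c \<subseteq> K \<and> K \<subseteq> chart_dom c)) \<and>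
     disjoint_family_on E F \<and> (\<Union>c\<in>F. E c) = UNIV"

definition integral_vol :: "('m::topological_space, 'k::finite) chart set \<Rightarrow> ('m, 'k) tensor2
    \<Rightarrow> (('m, 'k) chart \<Rightarrow> 'm \<Rightarrow> real) \<Rightarrow> real" where
  "integral_vol A g f = (case (SOME (F, E). chart_partition A F E) of (F, E) \<Rightarrow>
     (\<Sum>c\<in>F. LINT x:(crd c ` E c)|lborel. f c (inv_crd c x) * sqrt (det (g c (inv_crd c x)))))"

text \<open>\<open>is_adjoint_d A g \<eta> \<sigma>\<close> expresses \<open>\<sigma> = d\<^sup>*\<eta>\<close> for a 3-form \<open>\<eta>\<close>: the 2-form \<open>\<sigma>\<close> is the value at
  \<open>\<eta>\<close> of the formal \<open>L\<^sup>2\<close>-adjoint of \<open>d\<close> with respect to \<open>g\<close>. It is unique as the \<open>L\<^sup>2\<close> inner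
  product is positive definite.\<close>

definition is_adjoint_d :: "('m::topological_space, 'k::finite) chart set \<Rightarrow> ('m, 'k) tensor2
    \<Rightarrow> ('m, 'k) tensor3 \<Rightarrow> ('m, 'k) tensor2 \<Rightarrow> bool" where
  "is_adjoint_d A g \<eta> \<sigma> \<longleftrightarrow> two_form A \<sigma> \<and>
     (\<forall>\<alpha>. two_form A \<alpha> \<longrightarrow>
        integral_vol A g (inner3 g (ext_deriv \<alpha>) \<eta>) = integral_vol A g (inner2 g \<alpha> \<sigma>))"


section \<open>The flow\<close>

text \<open>In \<open>K1 \<omega> J \<sigma>\<close> the argument \<open>\<sigma>\<close> stands for \<open>d\<^sup>*d\<omega>\<close>.\<close>

definition K1 :: "('m, 'k::finite) tensor2 \<Rightarrow> ('m, 'k) tensor2 \<Rightarrow> ('m, 'k) tensor2 \<Rightarrow> ('m, 'k) tensor2"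
  where "K1 \<omega> J \<sigma> c p = (THE K. \<forall>x y. bil (metric \<omega> J c p) (K *v x) y =
     (bil (\<sigma> c p) (J c p *v x) (J c p *v y) - bil (\<sigma> c p) x y) / 2)"

definition B_endo :: "('m, 'k::finite) tensor2 \<Rightarrow> ('m, 'k) tensor2 \<Rightarrow> ('m, 'k) tensor2" where
  "B_endo \<omega> J c p = (THE K. \<forall>x y. bil (metric \<omega> J c p) (K *v x) y =
     bil (ricci (metric \<omega> J) c p) (J c p *v x) y + bil (ricci (metric \<omega> J) c p) x (J c p *v y))"

definition smooth_family :: "('m::topological_space, 'k::finite) chart set \<Rightarrow> real set
    \<Rightarrow> (real \<Rightarrow> ('m, 'k) tensor2) \<Rightarrow> bool" where
  "smooth_family A I \<alpha> \<longleftrightarrow>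
     (\<forall>c\<in>A. smooth_on (I \<times> crd c ` chart_dom c) (\<lambda>(t, x). \<alpha> t c (inv_crd c x)))"

definition has_time_derivative :: "('m, 'k::finite) chart set \<Rightarrow> real set
    \<Rightarrow> (real \<Rightarrow> ('m, 'k) tensor2) \<Rightarrow> ('m, 'k) tensor2 \<Rightarrow> real \<Rightarrow> bool" where
  "has_time_derivative A I \<alpha> \<alpha>' t \<longleftrightarrow> (\<forall>c\<in>A. \<forall>p\<in>chart_dom c.
     ((\<lambda>s. \<alpha> s c p) has_vector_derivative \<alpha>' c p) (at t within I))"

definition ddRicci_flow :: "('m::topological_space, 'k::finite) chart set \<Rightarrow> real set
    \<Rightarrow> (real \<Rightarrow> ('m, 'k) tensor2) \<Rightarrow> (real \<Rightarrow> ('m, 'k) tensor2) \<Rightarrow> bool" where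
  "ddRicci_flow A I \<omega> J \<longleftrightarrow>
     smooth_family A I \<omega> \<and> smooth_family A I J \<and>
     (\<forall>t\<in>I. almost_hermitian A (\<omega> t) (J t)) \<and>
     (\<forall>t\<in>I. \<exists>\<sigma>. is_adjoint_d A (metric (\<omega> t) (J t)) (ext_deriv (\<omega> t)) \<sigma> \<and>
        has_time_derivative A I \<omega> (\<lambda>c p. - \<sigma> c p) t \<and>
        has_time_derivative A I J (\<lambda>c p. K1 (\<omega> t) (J t) \<sigma> c p + B_endo (\<omega> t) (J t) c p) t)"

end

theory Submission
  imports Defs
begin

text \<open>
  Write \<open>\<eta>(t) = \<omega>(t) - \<omega>(0)\<close>, and consider the energy \<open>F(t)\<close>, the squared \<open>L\<^sup>2\<close> norm of \<open>\<eta>(t)\<close> with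
  respect to the metric \<open>g(t)\<close> of the same time. Differentiating \<open>\<eta>\<close> gives \<open>-2 \<langle>\<eta>, d\<^sup>*d\<omega>\<rangle>\<close>; since
  \<open>d\<omega>(0) = 0\<close> we have \<open>d\<eta> = d\<omega>\<close>, so this is \<open>-2 \<langle>d\<eta>, d\<omega>\<rangle> = -2 \<parallel>d\<omega>\<parallel>\<^sup>2 \<le> 0\<close>
  (\<open>adjoint_closed_background_nonneg\<close>). Differentiating the metric and the volume density
  contributes a quadratic form in \<open>\<eta>\<close> with bounded coefficients, which is at most \<open>C F\<close> because the
  metrics are uniformly positive on the compact set of times and points considered
  (\<open>energy_derivative_le\<close>). Hence \<open>F' \<le> C F\<close> and \<open>F(0) = 0\<close>, so \<open>F = 0\<close> by Gronwall's lemma and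
  \<open>\<omega>(t) = \<omega>(0)\<close> (\<open>flow_constant\<close>). Comparing \<open>\<eta>\<close> itself, rather than \<open>d\<omega>\<close>, with zero means that the
  flow equation never has to be differentiated in space.

  Once \<open>\<omega>\<close> is constant, \<open>d\<^sup>*d\<omega> = -\<partial>\<omega>/\<partial>t = 0\<close>, so \<open>K\<^sub>1\<close> vanishes and only \<open>B(\<omega>(0), J)\<close> drives \<open>J\<close>.

  The integral is a sum over Borel pieces in charts. The pieces depend on the atlas only, so the
  energies at different times are integrals over the same sets and the differentiation can be done
  piece by piece (\<open>chart_energy\<close>). The price is that \<open>F = 0\<close> yields \<open>\<eta> = 0\<close> only almost everywhere on
  pieces that may have empty interior; \<open>chart_cover_null_imp_empty\<close> upgrades this to \<open>\<eta> = 0\<close>.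
\<close>

section \<open>Positive definite kernels\<close>

definition qform :: "('i::finite \<Rightarrow> 'i \<Rightarrow> real) \<Rightarrow> ('i \<Rightarrow> real) \<Rightarrow> real" where
  "qform k f = (\<Sum>i\<in>UNIV. \<Sum>j\<in>UNIV. k i j * f i * f j)"

definition pos_def :: "('i::finite \<Rightarrow> 'i \<Rightarrow> real) \<Rightarrow> bool" where
  "pos_def k \<longleftrightarrow> (\<forall>f. f \<noteq> (\<lambda>_. 0) \<longrightarrow> 0 < qform k f)"

lemma qform_0 [simp]: "qform k (\<lambda>_. 0) = 0"
  by (simp add: qform_def)

lemma pos_def_nonneg: "pos_def k \<Longrightarrow> 0 \<le> qform k f"
  by (cases "f = (\<lambda>_. 0)") (auto simp: pos_def_def less_imp_le)

lemma pos_def_scale: "0 < a \<Longrightarrow> pos_def k \<Longrightarrow> pos_def (\<lambda>i j. k i j * a)"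
  by (simp add: pos_def_def qform_def mult.assoc[of _ a] mult.commute[of a]
      mult.assoc[symmetric] sum_distrib_right[symmetric])

lemma qform_rank_one:
  "qform (\<lambda>i j. h i j - c * (u i * u j)) f = qform h f - c * (\<Sum>i\<in>UNIV. u i * f i)\<^sup>2"
proof -
  have "(\<Sum>i\<in>UNIV. u i * f i)\<^sup>2 = (\<Sum>i\<in>UNIV. \<Sum>j\<in>UNIV. (u i * f i) * (u j * f j))"
    unfolding power2_eq_square by (rule sum_product)
  then show ?thesis
    unfolding qform_def sum_distrib_left sum_subtractf[symmetric]
    by (simp add: sum_distrib_left sum_subtractf[symmetric] algebra_simps)
qed

lemma qform_gram:
  assumes "\<And>i j. h i j = (\<Sum>m\<in>S. v m i * v m j)"
  shows "qform h f = (\<Sum>m\<in>S. (\<Sum>i\<in>UNIV. v m i * f i)\<^sup>2)"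
proof -
  have "qform h f = (\<Sum>i\<in>UNIV. \<Sum>j\<in>UNIV. \<Sum>m\<in>S. (v m i * f i) * (v m j * f j))"
    by (simp add: qform_def assms sum_distrib_right sum_distrib_left mult_ac)
  also have "\<dots> = (\<Sum>i\<in>UNIV. \<Sum>m\<in>S. \<Sum>j\<in>UNIV. (v m i * f i) * (v m j * f j))"
    by (intro sum.cong refl sum.swap)
  also have "\<dots> = (\<Sum>m\<in>S. \<Sum>i\<in>UNIV. \<Sum>j\<in>UNIV. (v m i * f i) * (v m j * f j))"
    by (rule sum.swap)
  also have "\<dots> = (\<Sum>m\<in>S. (\<Sum>i\<in>UNIV. v m i * f i)\<^sup>2)"
    by (simp only: power2_eq_square sum_product)
  finally show ?thesis .
qed

lemma qform_shift:
  assumes sym: "\<And>i j. h i j = h j i"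
  shows "qform h (\<lambda>i. f i + (if i = p then t else 0)) =
    qform h f + 2 * t * (\<Sum>i\<in>UNIV. h p i * f i) + t\<^sup>2 * h p p"
proof -
  have *: "h i j * (f i + (if i = p then t else 0)) * (f j + (if j = p then t else 0)) =
     h i j * f i * f j + (if i = p then t * (h p j * f j) else 0) + (if j = p then t * (h p i * f i) else 0)
     + (if i = p then if j = p then t\<^sup>2 * h p p else 0 else 0)" for i j
    using sym[of j p] sym[of i p] by (simp add: algebra_simps power2_eq_square)
  have 1: "(\<Sum>i\<in>UNIV. \<Sum>j\<in>UNIV. if i = p then t * (h p j * f j) else 0) = t * (\<Sum>i\<in>UNIV. h p i * f i)"
    by (subst sum.swap) (simp add: sum_distrib_left)
  have 2: "(\<Sum>i\<in>UNIV. \<Sum>j\<in>UNIV. if j = p then t * (h p i * f i) else 0) = t * (\<Sum>i\<in>UNIV. h p i * f i)"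
    by (simp add: sum_distrib_left)
  have 3: "(\<Sum>i\<in>UNIV. \<Sum>j\<in>UNIV. if i = p then if j = p then t\<^sup>2 * h p p else 0 else 0) = t\<^sup>2 * h p p"
    by (subst sum.swap) simp
  show ?thesis
    unfolding qform_def * sum.distrib 1 2 3 by simp
qed

lemma quadratic_discriminant_le:
  fixes q l a :: real
  assumes "\<And>t. 0 \<le> q + 2 * t * l + t\<^sup>2 * a" and "0 \<le> a"
  shows "0 \<le> q - l\<^sup>2 / a" and "a = 0 \<Longrightarrow> l = 0"
proof -
  show "0 \<le> q - l\<^sup>2 / a"
    using assms(1)[of "- l / a"] assms(1)[of 0]
    by (cases "a = 0") (auto simp: power2_eq_square field_simps)
  show "l = 0" if "a = 0"
  proof (rule ccontr)
    assume "l \<noteq> 0"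
    \<comment> \<open>at this \<open>t\<close> the left-hand side would be \<open>-1\<close>\<close>
    then show False
      using assms(1)[of "- (q + 1) / (2 * l)"] that by (simp add: field_simps)
  qed
qed

text \<open>Cholesky factorisation of a positive semidefinite matrix: one index is split off by completing the
  square, and the Schur complement is again positive semidefinite and supported on the others.\<close>

lemma gram_decomposition:
  assumes "finite S" and "\<And>i j. h i j = h j i" and "\<And>f. 0 \<le> qform h f"
    and "\<And>i j. i \<notin> S \<Longrightarrow> h i j = 0"
  shows "\<exists>v. \<forall>i j. h i j = (\<Sum>m\<in>S. v m i * v m j :: real)"
  using assms
proof (induction S arbitrary: h rule: finite_induct)
  case empty
  then show ?case by simp
next
  case (insert p S)
  have quad: "0 \<le> qform h f + 2 * t * (\<Sum>i\<in>UNIV. h p i * f i) + t\<^sup>2 * h p p" for f t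
    using insert.prems(2)[of "\<lambda>i. f i + (if i = p then t else 0)"]
    by (simp only: qform_shift[OF insert.prems(1)])
  have "0 \<le> h p p"
    using quad[of "\<lambda>_. 0" 1] by simp
  note disc = quadratic_discriminant_le[OF quad \<open>0 \<le> h p p\<close>]
  have row: "h p i = 0" if "h p p = 0" for i
    using disc(2)[OF that, of "\<lambda>j. if j = i then 1 else 0"]
    by (simp add: if_distrib cong: if_cong)
  \<comment> \<open>Completing the square in the direction \<open>p\<close>. If \<open>h p p = 0\<close>, the whole row of \<open>p\<close> vanishes by
    \<open>row\<close>, and the formulas below stay correct because division by zero yields zero.\<close>
  define h' where "h' = (\<lambda>i j. h i j - 1 / h p p * (h p i * h p j))"
  have "\<exists>v. \<forall>i j. h' i j = (\<Sum>m\<in>S. v m i * v m j)"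
  proof (rule insert.IH)
    show "h' i j = h' j i" for i j
      using insert.prems(1)[of i j] by (simp add: h'_def)
    show "0 \<le> qform h' f" for f
      unfolding h'_def qform_rank_one using disc(1) by simp
    show "h' i j = 0" if "i \<notin> S" for i j
    proof (cases "i = p")
      case True
      then show ?thesis using row[of j] by (cases "h p p = 0") (auto simp: h'_def)
    next
      case False
      then have "h i j = 0" "h p i = 0"
        using insert.prems(3)[of i] insert.prems(1)[of p i] that by auto
      then show ?thesis by (simp add: h'_def)
    qed
  qed
  then obtain v where v: "\<And>i j. h' i j = (\<Sum>m\<in>S. v m i * v m j)" by blast
  have "h i j = (\<Sum>m\<in>insert p S. (v(p := \<lambda>i. h p i / sqrt (h p p))) m i *
      (v(p := \<lambda>i. h p i / sqrt (h p p))) m j)" for i j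
  proof -
    have "(\<Sum>m\<in>S. (v(p := \<lambda>i. h p i / sqrt (h p p))) m i * (v(p := \<lambda>i. h p i / sqrt (h p p))) m j)
        = h' i j"
      unfolding v using insert.hyps(2) by (intro sum.cong) auto
    then show ?thesis
      using insert.hyps \<open>0 \<le> h p p\<close> by (simp add: h'_def)
  qed
  then show ?case by blast
qed

text \<open>This makes the inner products induced by a metric on tensors of higher rank positive definite:
  their coefficients are products of entries of the inverse metric, one factor for each slot.\<close>

lemma pos_def_tensor:
  fixes h :: "'i::finite \<Rightarrow> 'i \<Rightarrow> real" and k :: "'j::finite \<Rightarrow> 'j \<Rightarrow> real"
  assumes sym: "\<And>i j. h i j = h j i" and h: "pos_def h" and k: "pos_def k"
  shows "pos_def (\<lambda>x y. h (fst x) (fst y) * k (snd x) (snd y))"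
  unfolding pos_def_def
proof (intro allI impI)
  fix f :: "'i \<times> 'j \<Rightarrow> real"
  assume f: "f \<noteq> (\<lambda>_. 0)"
  have "\<exists>v. \<forall>i j. h i j = (\<Sum>m\<in>(UNIV :: 'i set). v m i * v m j)"
    by (rule gram_decomposition[OF finite sym pos_def_nonneg[OF h]]) simp
  then obtain v :: "'i \<Rightarrow> 'i \<Rightarrow> real" where v: "\<And>i j. h i j = (\<Sum>m\<in>UNIV. v m i * v m j)"
    by blast
  define y where "y m j = (\<Sum>i\<in>UNIV. v m i * f (i, j))" for m j
  \<comment> \<open>With \<open>h = \<Sum>\<^sub>m v\<^sub>m v\<^sub>m\<^sup>T\<close> the tensor form is a sum of values of \<open>k\<close> at the contractions
    of \<open>f\<close> with the \<open>v\<^sub>m\<close>.\<close>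
  let ?q = "\<lambda>m i a j b. v m i * v m a * (k j b * f (i, j) * f (a, b))"
  have "qform (\<lambda>x y. h (fst x) (fst y) * k (snd x) (snd y)) f =
      (\<Sum>i\<in>UNIV. \<Sum>j\<in>UNIV. \<Sum>a\<in>UNIV. \<Sum>b\<in>UNIV. h i a * k j b * f (i, j) * f (a, b))"
    by (simp only: qform_def UNIV_Times_UNIV[symmetric] sum.cartesian_product' fst_conv snd_conv)
  also have "\<dots> = (\<Sum>i\<in>UNIV. \<Sum>a\<in>UNIV. \<Sum>j\<in>UNIV. \<Sum>b\<in>UNIV. h i a * (k j b * f (i, j) * f (a, b)))"
    by (subst sum.swap) (simp only: mult.assoc)
  also have "\<dots> = (\<Sum>i\<in>UNIV. \<Sum>a\<in>UNIV. h i a * (\<Sum>j\<in>UNIV. \<Sum>b\<in>UNIV. k j b * f (i, j) * f (a, b)))"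
    by (simp only: sum_distrib_left)
  also have "\<dots> = (\<Sum>i\<in>UNIV. \<Sum>a\<in>UNIV. \<Sum>m\<in>UNIV. \<Sum>j\<in>UNIV. \<Sum>b\<in>UNIV. ?q m i a j b)"
    unfolding v sum_distrib_right by (simp only: sum_distrib_left)
  also have "\<dots> = (\<Sum>i\<in>UNIV. \<Sum>m\<in>UNIV. \<Sum>a\<in>UNIV. \<Sum>j\<in>UNIV. \<Sum>b\<in>UNIV. ?q m i a j b)"
    by (intro sum.cong refl sum.swap)
  also have "\<dots> = (\<Sum>m\<in>UNIV. \<Sum>i\<in>UNIV. \<Sum>a\<in>UNIV. \<Sum>j\<in>UNIV. \<Sum>b\<in>UNIV. ?q m i a j b)"
    by (rule sum.swap)
  also have "\<dots> = (\<Sum>m\<in>UNIV. \<Sum>i\<in>UNIV. \<Sum>j\<in>UNIV. \<Sum>a\<in>UNIV. \<Sum>b\<in>UNIV. ?q m i a j b)"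
    by (intro sum.cong refl sum.swap)
  also have "\<dots> = (\<Sum>m\<in>UNIV. \<Sum>i\<in>UNIV. \<Sum>j\<in>UNIV. \<Sum>b\<in>UNIV. \<Sum>a\<in>UNIV. ?q m i a j b)"
    by (intro sum.cong refl sum.swap)
  also have "\<dots> = (\<Sum>m\<in>UNIV. \<Sum>j\<in>UNIV. \<Sum>i\<in>UNIV. \<Sum>b\<in>UNIV. \<Sum>a\<in>UNIV. ?q m i a j b)"
    by (intro sum.cong refl sum.swap)
  also have "\<dots> = (\<Sum>m\<in>UNIV. \<Sum>j\<in>UNIV. \<Sum>b\<in>UNIV. \<Sum>i\<in>UNIV. \<Sum>a\<in>UNIV. ?q m i a j b)"
    by (intro sum.cong refl sum.swap)
  also have "\<dots> = (\<Sum>m\<in>UNIV. \<Sum>j\<in>UNIV. \<Sum>b\<in>UNIV. \<Sum>i\<in>UNIV. \<Sum>a\<in>UNIV.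
      k j b * ((v m i * f (i, j)) * (v m a * f (a, b))))"
    by (intro sum.cong refl) (simp only: mult_ac)
  also have "\<dots> = (\<Sum>m\<in>UNIV. qform k (y m))"
  proof -
    have "k j b * y m j * y m b = (\<Sum>i\<in>UNIV. \<Sum>a\<in>UNIV. k j b * ((v m i * f (i, j)) * (v m a * f (a, b))))"
      for m j b
      by (simp add: y_def mult.assoc sum_product) (simp only: sum_distrib_left)
    then show ?thesis by (simp only: qform_def)
  qed
  finally have eq: "qform (\<lambda>x y. h (fst x) (fst y) * k (snd x) (snd y)) f = (\<Sum>m\<in>UNIV. qform k (y m))" .
  moreover have "(\<Sum>m\<in>UNIV. qform k (y m)) \<noteq> 0"
  proof
    assume "(\<Sum>m\<in>UNIV. qform k (y m)) = 0"
    then have "qform k (y m) = 0" for m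
      using sum_nonneg_eq_0_iff[of UNIV "\<lambda>m. qform k (y m)"] pos_def_nonneg[OF k] by simp
    then have "y m = (\<lambda>_. 0)" for m
      using k unfolding pos_def_def by (metis less_irrefl)
    then have "qform h (\<lambda>i. f (i, j)) = 0" for j
      unfolding qform_gram[OF v] by (auto simp: y_def fun_eq_iff)
    then have "(\<lambda>i. f (i, j)) = (\<lambda>_. 0)" for j
      using h unfolding pos_def_def by (metis less_irrefl)
    then show False
      using f by (auto simp: fun_eq_iff)
  qed
  moreover have "0 \<le> (\<Sum>m\<in>UNIV. qform k (y m))"
    by (intro sum_nonneg pos_def_nonneg[OF k])
  ultimately show "0 < qform (\<lambda>x y. h (fst x) (fst y) * k (snd x) (snd y)) f"
    by linarith
qed

text \<open>The minimum over the product of \<open>Z\<close> with the unit sphere is attained, hence positive, and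
  homogeneity extends the bound to all vectors.\<close>

lemma uniform_coercivity:
  fixes P :: "'i::finite \<Rightarrow> 'i \<Rightarrow> 'z::topological_space \<Rightarrow> real"
  assumes Z: "compact Z" and cont: "\<And>i j. continuous_on Z (P i j)"
    and pos: "\<And>z. z \<in> Z \<Longrightarrow> pos_def (\<lambda>i j. P i j z)"
  shows "\<exists>c>0. \<forall>z\<in>Z. \<forall>f. c * (\<Sum>i\<in>UNIV. (f i)\<^sup>2) \<le> qform (\<lambda>i j. P i j z) f"
proof (cases "Z = {}")
  case True
  then show ?thesis by (auto intro: exI[of _ 1])
next
  case False
  let ?S = "Z \<times> sphere (0 :: real^'i) 1"
  let ?q = "\<lambda>y. qform (\<lambda>i j. P i j (fst y)) (\<lambda>i. snd y $ i)"
  have "continuous_on ?S (\<lambda>y. P i j (fst y))" for i j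
    by (rule continuous_on_compose2[OF cont]) (auto intro!: continuous_intros)
  then have "continuous_on ?S ?q"
    unfolding qform_def by (intro continuous_intros)
  moreover have "compact ?S" using Z by (intro compact_Times) auto
  moreover have "?S \<noteq> {}"
  proof -
    obtain z where "z \<in> Z" using False by blast
    then have "(z, axis undefined 1) \<in> ?S" by (simp add: norm_axis_1)
    then show ?thesis by blast
  qed
  ultimately obtain y where y: "y \<in> ?S" "\<And>y'. y' \<in> ?S \<Longrightarrow> ?q y \<le> ?q y'"
    using continuous_attains_inf[of ?S ?q] by blast
  have "(\<lambda>i. snd y $ i) \<noteq> (\<lambda>_. 0)"
  proof
    assume "(\<lambda>i. snd y $ i) = (\<lambda>_. 0)"
    then have "snd y = 0" by (simp add: vec_eq_iff fun_eq_iff)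
    then show False using y(1) by auto
  qed
  then have "0 < ?q y"
    using pos[of "fst y"] y(1) unfolding pos_def_def by auto
  moreover have "?q y * (\<Sum>i\<in>UNIV. (f i)\<^sup>2) \<le> qform (\<lambda>i j. P i j z) f" if z: "z \<in> Z" for z f
  proof -
    define u :: "real^'i" where "u = (\<chi> i. f i)"
    have r: "(norm u)\<^sup>2 = (\<Sum>i\<in>UNIV. (f i)\<^sup>2)"
      by (simp add: u_def norm_vec_def L2_set_def sum_nonneg)
    show ?thesis
    proof (cases "u = 0")
      case True
      then have "f = (\<lambda>_. 0)" by (simp add: u_def vec_eq_iff fun_eq_iff)
      then show ?thesis by simp
    next
      case False
      have "(z, u /\<^sub>R norm u) \<in> ?S" using z False by simp
      then have "?q y \<le> qform (\<lambda>i j. P i j z) (\<lambda>i. f i / norm u)"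
        using y(2)[of "(z, u /\<^sub>R norm u)"] by (simp add: u_def divide_inverse mult.commute)
      also have "\<dots> = qform (\<lambda>i j. P i j z) f / (norm u)\<^sup>2"
        by (simp add: qform_def sum_divide_distrib power2_eq_square)
      finally show ?thesis
        using False unfolding r[symmetric] by (simp add: pos_le_divide_eq)
    qed
  qed
  ultimately show ?thesis by blast
qed

lemma qform_le_sum_squares:
  fixes k :: "'i::finite \<Rightarrow> 'i \<Rightarrow> real"
  assumes "\<And>i j. \<bar>k i j\<bar> \<le> M"
  shows "qform k f \<le> M * CARD('i) * (\<Sum>i\<in>UNIV. (f i)\<^sup>2)"
proof -
  have entry: "k i j * f i * f j \<le> M * ((f i)\<^sup>2 + (f j)\<^sup>2) / 2" for i j
  proof -
    have "k i j * f i * f j \<le> \<bar>k i j\<bar> * \<bar>f i * f j\<bar>"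
      by (metis abs_ge_self abs_mult mult.assoc)
    also have "\<dots> \<le> M * (((f i)\<^sup>2 + (f j)\<^sup>2) / 2)"
    proof (rule mult_mono)
      show "\<bar>k i j\<bar> \<le> M" "0 \<le> M" using assms[of i j] by auto
      show "\<bar>f i * f j\<bar> \<le> ((f i)\<^sup>2 + (f j)\<^sup>2) / 2"
        using sum_squares_bound[of "\<bar>f i\<bar>" "\<bar>f j\<bar>"] by (simp add: abs_mult)
    qed simp
    finally show ?thesis by simp
  qed
  have "qform k f \<le> (\<Sum>i\<in>UNIV. \<Sum>j\<in>UNIV. M * ((f i)\<^sup>2 + (f j)\<^sup>2) / 2)"
    unfolding qform_def by (intro sum_mono entry)
  also have "\<dots> = M * (\<Sum>i\<in>(UNIV::'i set). \<Sum>j\<in>(UNIV::'i set). (f i)\<^sup>2 + (f j)\<^sup>2) / 2"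
    by (simp only: sum_distrib_left sum_divide_distrib)
  also have "\<dots> = M * CARD('i) * (\<Sum>i\<in>UNIV. (f i)\<^sup>2)"
    by (simp add: sum.distrib sum_distrib_left[symmetric])
  finally show ?thesis .
qed

section \<open>Positive definite matrices\<close>

lemma matrix_inv_inverse:
  fixes A :: "real^'k::finite^'k"
  assumes "det A \<noteq> 0"
  shows "A ** matrix_inv A = mat 1" and "matrix_inv A ** A = mat 1"
  using someI_ex[OF assms[folded invertible_det_nz, unfolded invertible_def]]
  by (auto simp: matrix_inv_def)

lemma matrix_inv_cramer:
  fixes A :: "real^'k::finite^'k"
  assumes "det A \<noteq> 0"
  shows "matrix_inv A $ i $ j =
    det (\<chi> r s. if s = i then axis j 1 $ r else A $ r $ s) * inverse (det A)"
proof -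
  have "A ** matrix_inv A = mat 1"
    using assms by (rule matrix_inv_inverse)
  then have "A *v (matrix_inv A *v axis j 1) = axis j 1"
    by (simp add: matrix_vector_mul_assoc)
  then have "matrix_inv A *v axis j 1 =
      (\<chi> k. det (\<chi> r s. if s = k then axis j 1 $ r else A $ r $ s) / det A)"
    using cramer[OF assms] by blast
  moreover have "(matrix_inv A *v axis j 1) $ i = matrix_inv A $ i $ j"
    by (simp add: matrix_vector_mult_basis column_def)
  ultimately show ?thesis
    by (simp add: divide_inverse)
qed

lemma bil_axis: "bil a (axis i 1) (axis j 1) = a $ i $ j"
  by (simp add: matrix_vector_mult_basis column_def inner_axis')

lemma bil_qform: "bil a x x = qform (\<lambda>i j. a $ i $ j) (\<lambda>i. x $ i)"
  by (simp add: inner_vec_def matrix_vector_mult_def qform_def sum_distrib_left mult_ac)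

definition pos_def_matrix :: "real^'k::finite^'k \<Rightarrow> bool" where
  "pos_def_matrix g \<longleftrightarrow> (\<forall>x y. bil g x y = bil g y x) \<and> (\<forall>x. x \<noteq> 0 \<longrightarrow> 0 < bil g x x)"

lemma pos_def_matrix_nonsingular:
  assumes "\<And>x. x \<noteq> 0 \<Longrightarrow> 0 < bil g x x"
  shows "det g \<noteq> 0"
proof -
  have "x = 0" if "g *v x = 0" for x
    using assms[of x] that by force
  then show ?thesis
    using matrix_left_invertible_ker[of g] invertible_det_nz invertible_left_inverse by blast
qed

lemma pos_def_matrix_det_pos:
  assumes g: "pos_def_matrix g"
  shows "0 < det g"
proof (rule ccontr)
  assume neg: "\<not> 0 < det g"
  \<comment> \<open>the segment from the identity to \<open>g\<close> stays positive definite, so \<open>det\<close> cannot change sign on it\<close>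
  let ?h = "\<lambda>s. (1 - s) *\<^sub>R mat 1 + s *\<^sub>R g"
  have "continuous_on {0..1} (\<lambda>s. det (?h s))"
    unfolding det_def by (intro continuous_intros)
  moreover have "det (?h 0) = 1" "det (?h 1) = det g" by simp_all
  ultimately obtain s where s: "0 \<le> s" "s \<le> 1" "det (?h s) = 0"
    using IVT2'[of "\<lambda>s. det (?h s)" 1 0 0] neg by auto
  have "0 < bil (?h s) x x" if "x \<noteq> 0" for x
  proof -
    have "bil (?h s) x x = (1 - s) * (x \<bullet> x) + s * bil g x x"
      by (simp add: matrix_vector_mult_add_rdistrib inner_add_right scaleR_matrix_vector_assoc[symmetric])
    moreover have "0 < x \<bullet> x" "0 < bil g x x" using that g by (auto simp: pos_def_matrix_def)
    ultimately show ?thesis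
      using s(1,2) add_nonneg_pos[of "(1 - s) * (x \<bullet> x)" "s * bil g x x"] by (cases "s = 0") simp_all
  qed
  then show False using pos_def_matrix_nonsingular s(3) by blast
qed

lemma pos_def_matrix_entries:
  assumes g: "pos_def_matrix g"
  shows "g $ i $ j = g $ j $ i" and "pos_def (\<lambda>i j. g $ i $ j)"
proof -
  show "g $ i $ j = g $ j $ i"
    using g unfolding pos_def_matrix_def by (metis bil_axis)
  show "pos_def (\<lambda>i j. g $ i $ j)"
    unfolding pos_def_def
  proof (intro allI impI)
    fix f :: "'a \<Rightarrow> real"
    assume f: "f \<noteq> (\<lambda>_. 0)"
    let ?x = "\<chi> i. f i"
    have "?x \<noteq> 0" using f by (auto simp: vec_eq_iff)
    then have "0 < bil g ?x ?x" using g unfolding pos_def_matrix_def by blast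
    moreover have "(\<lambda>i. ?x $ i) = f" by simp
    ultimately show "0 < qform (\<lambda>i j. g $ i $ j) f" unfolding bil_qform by (simp only:)
  qed
qed

text \<open>The substitution \<open>x = g y\<close> turns the form of the inverse matrix into that of \<open>g\<close>.\<close>

lemma pos_def_matrix_inv:
  assumes g: "pos_def_matrix g"
  shows "pos_def_matrix (matrix_inv g)"
proof -
  have inv: "g *v (matrix_inv g *v x) = x" for x
    using matrix_inv_inverse(1)[of g] pos_def_matrix_det_pos[OF g]
    by (simp add: matrix_vector_mul_assoc)
  have *: "bil (matrix_inv g) x y = bil g (matrix_inv g *v y) (matrix_inv g *v x)" for x y
    using inv by (metis inner_commute)
  show ?thesis
    unfolding pos_def_matrix_def
  proof (intro conjI allI impI)
    show "bil (matrix_inv g) x y = bil (matrix_inv g) y x" for x y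
      using g unfolding * pos_def_matrix_def by blast
    show "0 < bil (matrix_inv g) x x" if "x \<noteq> 0" for x
    proof -
      have "matrix_inv g *v x \<noteq> 0" using inv[of x] that by auto
      then show ?thesis using g unfolding * pos_def_matrix_def by blast
    qed
  qed
qed

section \<open>Functions continuously differentiable in time\<close>

text \<open>Only the time variable is differentiated, one-sidedly at the end points. Joint continuity of the
  function and its derivative provides bounds uniform in space and time over a compact \<open>K\<close>, which is
  all that differentiation under the integral and the Gronwall estimate use; and the class is closed
  under the algebraic operations that lead from \<open>\<omega>\<close> and \<open>J\<close> to the inverse metric and the volume density.\<close>

definition time_C1 :: "real \<Rightarrow> 'x::topological_space set \<Rightarrow> (real \<Rightarrow> 'x \<Rightarrow> real) \<Rightarrow> (real \<Rightarrow> 'x \<Rightarrow> real) \<Rightarrow> bool" where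
  "time_C1 T K f f' \<longleftrightarrow> continuous_on ({0..T} \<times> K) (\<lambda>z. f (fst z) (snd z)) \<and>
     continuous_on ({0..T} \<times> K) (\<lambda>z. f' (fst z) (snd z)) \<and>
     (\<forall>t\<in>{0..T}. \<forall>x\<in>K. ((\<lambda>s. f s x) has_real_derivative f' t x) (at t within {0..T}))"

lemma time_C1_time_independent:
  assumes "continuous_on K h"
  shows "time_C1 T K (\<lambda>_ x. h x) (\<lambda>_ _. 0)"
proof -
  have "continuous_on ({0..T} \<times> K) (\<lambda>z. h (snd z))"
    by (rule continuous_on_compose2[OF assms continuous_on_snd[OF continuous_on_id]]) auto
  then show ?thesis by (simp add: time_C1_def)
qed

lemma time_C1_const: "time_C1 T K (\<lambda>_ _. c) (\<lambda>_ _. 0)"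
  by (simp add: time_C1_def)

lemma time_C1_cong:
  assumes eq: "\<And>t x. t \<in> {0..T} \<Longrightarrow> x \<in> K \<Longrightarrow> g t x = f t x" and f: "time_C1 T K f f'"
  shows "time_C1 T K g f'"
proof -
  have "continuous_on ({0..T} \<times> K) (\<lambda>z. g (fst z) (snd z)) \<longleftrightarrow>
      continuous_on ({0..T} \<times> K) (\<lambda>z. f (fst z) (snd z))"
    by (rule continuous_on_cong) (auto simp: eq)
  moreover have "((\<lambda>s. g s x) has_real_derivative f' t x) (at t within {0..T})"
    if "t \<in> {0..T}" "x \<in> K" for t x
    using f that eq unfolding time_C1_def has_field_derivative_def
    by (auto intro: has_derivative_transform[where f="\<lambda>s. f s x"])
  ultimately show ?thesis
    using f unfolding time_C1_def by blast
qed

text \<open>Transfers continuity of the derivative to any function known to be the derivative pointwise. In this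
  way \<open>d\<^sup>*d\<omega>\<close>, of which only smoothness in space is given, becomes continuous in space and time.\<close>

lemma time_C1_cong_deriv:
  assumes f: "time_C1 T K f f'" and T: "0 < T"
    and g: "\<And>t x. t \<in> {0..T} \<Longrightarrow> x \<in> K \<Longrightarrow> ((\<lambda>s. f s x) has_real_derivative g t x) (at t within {0..T})"
  shows "time_C1 T K f g"
proof -
  have "g t x = f' t x" if tx: "t \<in> {0..T}" "x \<in> K" for t x
  proof (rule vector_derivative_unique_within_closed_interval[OF T, of t "\<lambda>s. f s x"])
    show "t \<in> cbox 0 T" using tx by simp
    show "((\<lambda>s. f s x) has_vector_derivative g t x) (at t within cbox 0 T)"
      using g[OF tx] by (simp add: has_real_derivative_iff_has_vector_derivative)
    show "((\<lambda>s. f s x) has_vector_derivative f' t x) (at t within cbox 0 T)"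
      using f tx unfolding time_C1_def by (simp add: has_real_derivative_iff_has_vector_derivative)
  qed
  then have "continuous_on ({0..T} \<times> K) (\<lambda>z. g (fst z) (snd z)) \<longleftrightarrow>
      continuous_on ({0..T} \<times> K) (\<lambda>z. f' (fst z) (snd z))"
    by (intro continuous_on_cong) auto
  then show ?thesis using f g unfolding time_C1_def by blast
qed

lemma time_C1_add:
  "time_C1 T K f f' \<Longrightarrow> time_C1 T K g g' \<Longrightarrow> time_C1 T K (\<lambda>t x. f t x + g t x) (\<lambda>t x. f' t x + g' t x)"
  unfolding time_C1_def by (auto intro!: continuous_intros derivative_intros)

lemma time_C1_mult:
  "time_C1 T K f f' \<Longrightarrow> time_C1 T K g g' \<Longrightarrow>
    time_C1 T K (\<lambda>t x. f t x * g t x) (\<lambda>t x. f' t x * g t x + f t x * g' t x)"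
  unfolding time_C1_def by (auto intro!: continuous_intros derivative_eq_intros)

lemma time_C1_sum:
  "finite S \<Longrightarrow> (\<And>i. i \<in> S \<Longrightarrow> time_C1 T K (f i) (f' i)) \<Longrightarrow>
    time_C1 T K (\<lambda>t x. \<Sum>i\<in>S. f i t x) (\<lambda>t x. \<Sum>i\<in>S. f' i t x)"
  by (induction S rule: finite_induct) (simp_all add: time_C1_const time_C1_add)

lemma time_C1_inverse:
  assumes "time_C1 T K f f'" and nz: "\<And>t x. t \<in> {0..T} \<Longrightarrow> x \<in> K \<Longrightarrow> f t x \<noteq> 0"
  shows "time_C1 T K (\<lambda>t x. inverse (f t x)) (\<lambda>t x. - f' t x / (f t x)\<^sup>2)"
  using assms unfolding time_C1_def
  by (auto intro!: continuous_intros derivative_eq_intros simp: power2_eq_square field_simps)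

lemma time_C1_sqrt:
  assumes "time_C1 T K f f'" and pos: "\<And>t x. t \<in> {0..T} \<Longrightarrow> x \<in> K \<Longrightarrow> 0 < f t x"
  shows "time_C1 T K (\<lambda>t x. sqrt (f t x)) (\<lambda>t x. f' t x / (2 * sqrt (f t x)))"
proof -
  have "((\<lambda>s. sqrt (f s x)) has_real_derivative f' t x / (2 * sqrt (f t x))) (at t within {0..T})"
    if tx: "t \<in> {0..T}" "x \<in> K" for t x
  proof -
    have "((\<lambda>s. f s x) has_real_derivative f' t x) (at t within {0..T})"
      using assms(1) tx unfolding time_C1_def by blast
    from DERIV_chain2[where g="\<lambda>s. f s x", OF DERIV_real_sqrt[OF pos[OF tx]] this]
    show ?thesis by (simp add: field_simps)
  qed
  moreover have "f (fst z) (snd z) \<noteq> 0" if "z \<in> {0..T} \<times> K" for z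
    using pos[of "fst z" "snd z"] that by auto
  ultimately show ?thesis
    using assms(1) unfolding time_C1_def by (intro conjI continuous_intros ballI) auto
qed

lemma time_C1_prod:
  assumes "finite S" and "\<And>i. i \<in> S \<Longrightarrow> \<exists>f'. time_C1 T K (f i) f'"
  shows "\<exists>f'. time_C1 T K (\<lambda>t x. \<Prod>i\<in>S. f i t x) f'"
  using assms
proof (induction S rule: finite_induct)
  case empty
  then show ?case by (auto intro: time_C1_const)
next
  case (insert i S)
  then obtain f' g' where "time_C1 T K (f i) f'" "time_C1 T K (\<lambda>t x. \<Prod>i\<in>S. f i t x) g'"
    by blast
  from time_C1_mult[OF this] show ?case
    using insert.hyps by auto
qed

lemma time_C1_det:
  fixes a :: "real \<Rightarrow> 'x::topological_space \<Rightarrow> real^'k::finite^'k"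
  assumes "\<And>i j. \<exists>f'. time_C1 T K (\<lambda>t x. a t x $ i $ j) f'"
  shows "\<exists>f'. time_C1 T K (\<lambda>t x. det (a t x)) f'"
proof -
  have "\<exists>f'. time_C1 T K (\<lambda>t x. \<Prod>i\<in>UNIV. a t x $ i $ p i) f'" for p :: "'k \<Rightarrow> 'k"
    by (intro time_C1_prod assms finite)
  note summand = time_C1_mult[OF time_C1_const someI_ex[OF this]]
  show ?thesis
    unfolding det_def by (rule exI, rule time_C1_sum, simp add: finite_permutations, rule summand)
qed

text \<open>By Cramer's rule the inverse is built from determinants and a division by a nonvanishing function.\<close>

lemma time_C1_matrix_inv:
  fixes a :: "real \<Rightarrow> 'x::topological_space \<Rightarrow> real^'k::finite^'k"
  assumes a: "\<And>i j. \<exists>f'. time_C1 T K (\<lambda>t x. a t x $ i $ j) f'"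
    and nz: "\<And>t x. t \<in> {0..T} \<Longrightarrow> x \<in> K \<Longrightarrow> det (a t x) \<noteq> 0"
  shows "\<exists>f'. time_C1 T K (\<lambda>t x. matrix_inv (a t x) $ i $ j) f'"
proof -
  let ?f = "\<lambda>t x. det (\<chi> r s. if s = i then axis j 1 $ r else a t x $ r $ s) * inverse (det (a t x))"
  have "\<exists>f'. time_C1 T K (\<lambda>t x. (\<chi> r s. if s = i then axis j 1 $ r else a t x $ r $ s) $ r $ s) f'"
    for r s
    using a[of r s] time_C1_const by (cases "s = i") auto
  from time_C1_det[OF this] time_C1_det[OF a] obtain f' g' where
    "time_C1 T K (\<lambda>t x. det (\<chi> r s. if s = i then axis j 1 $ r else a t x $ r $ s)) f'"
    "time_C1 T K (\<lambda>t x. det (a t x)) g'" by blast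
  then obtain h' where h': "time_C1 T K ?f h'"
    using nz time_C1_inverse time_C1_mult by blast
  have "matrix_inv (a t x) $ i $ j = ?f t x" if "t \<in> {0..T}" "x \<in> K" for t x
    by (rule matrix_inv_cramer[OF nz[OF that]])
  then have "time_C1 T K (\<lambda>t x. matrix_inv (a t x) $ i $ j) h'"
    by (rule time_C1_cong[OF _ h'])
  then show ?thesis by blast
qed

lemma time_C1_bounded:
  assumes f: "time_C1 T K f f'" and "compact K"
  shows "\<exists>M\<ge>0. \<forall>t\<in>{0..T}. \<forall>x\<in>K. \<bar>f t x\<bar> \<le> M \<and> \<bar>f' t x\<bar> \<le> M"
proof -
  have "compact ((\<lambda>z. f (fst z) (snd z)) ` ({0..T} \<times> K))" "compact ((\<lambda>z. f' (fst z) (snd z)) ` ({0..T} \<times> K))"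
    using f \<open>compact K\<close> unfolding time_C1_def
    by (auto intro!: compact_continuous_image compact_Times)
  then obtain a b where "\<forall>y\<in>(\<lambda>z. f (fst z) (snd z)) ` ({0..T} \<times> K). norm y \<le> a"
    "\<forall>y\<in>(\<lambda>z. f' (fst z) (snd z)) ` ({0..T} \<times> K). norm y \<le> b"
    using compact_imp_bounded bounded_iff by metis
  then show ?thesis
    by (intro exI[of _ "max 0 (max a b)"]) (auto simp: le_max_iff_disj)
qed

lemma time_C1_continuous_on:
  assumes "time_C1 T K f f'" and "t \<in> {0..T}"
  shows "continuous_on K (f t)" and "continuous_on K (f' t)"
proof -
  have "continuous_on K (\<lambda>x. (t, x))" "(\<lambda>x. (t, x)) ` K \<subseteq> {0..T} \<times> K"
    using assms(2) by (auto intro!: continuous_intros)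
  then show "continuous_on K (f t)" "continuous_on K (f' t)"
    using assms(1) continuous_on_compose2[of "{0..T} \<times> K" _ K "\<lambda>x. (t, x)"]
    unfolding time_C1_def by fastforce+
qed

section \<open>Integrals depending on time\<close>

lemma set_lebesgue_integral_nonneg:
  fixes f :: "'a \<Rightarrow> real"
  assumes "\<And>x. x \<in> U \<Longrightarrow> 0 \<le> f x"
  shows "0 \<le> (LINT x:U|M. f x)"
  unfolding set_lebesgue_integral_def
  by (rule Bochner_Integration.integral_nonneg) (simp add: assms indicator_def)

lemma set_integral_0_negligible:
  fixes f :: "'a::euclidean_space \<Rightarrow> real"
  assumes int: "set_integrable lborel U f" and nn: "\<And>x. x \<in> U \<Longrightarrow> 0 \<le> f x"
    and 0: "(LINT x:U|lborel. f x) = 0"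
  shows "negligible {x \<in> U. f x \<noteq> 0}"
proof -
  let ?f = "\<lambda>x. indicator U x *\<^sub>R f x"
  have "AE x in lborel. ?f x = 0"
    using int 0 nn unfolding set_integrable_def set_lebesgue_integral_def
    by (subst integral_nonneg_eq_0_iff_AE[symmetric]) (auto simp: indicator_def)
  then obtain N where N: "{x. ?f x \<noteq> 0} \<subseteq> N" "N \<in> null_sets lborel"
    unfolding eventually_ae_filter by auto
  then have "negligible N"
    using null_sets_completionI[of N lborel] by (simp add: negligible_iff_null_sets)
  moreover have "{x \<in> U. f x \<noteq> 0} \<subseteq> N" using N(1) by auto
  ultimately show ?thesis by (rule negligible_subset)
qed

lemma set_integrable_compact_subset:
  fixes f :: "'a::euclidean_space \<Rightarrow> real"
  assumes "compact K" "U \<subseteq> K" "U \<in> sets borel" "continuous_on K f"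
  shows "set_integrable lborel U f"
proof -
  have "set_integrable lborel K f"
    using borel_integrable_compact[OF assms(1,4)] by (simp add: set_integrable_def)
  then show ?thesis
    by (rule set_integrable_subset) (use assms in auto)
qed

text \<open>Difference quotients in time are bounded by the supremum of the derivative, so dominated
  convergence applies along every sequence of times.\<close>

lemma set_integral_time_derivative:
  fixes f :: "real \<Rightarrow> 'a::euclidean_space \<Rightarrow> real"
  assumes f: "time_C1 T K f f'" and K: "compact K" "U \<subseteq> K" "U \<in> sets borel" and t: "t \<in> {0..T}"
  shows "((\<lambda>s. LINT x:U|lborel. f s x) has_real_derivative (LINT x:U|lborel. f' t x)) (at t within {0..T})"
proof -
  obtain M where M: "0 \<le> M" "\<And>s x. s \<in> {0..T} \<Longrightarrow> x \<in> K \<Longrightarrow> \<bar>f' s x\<bar> \<le> M"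
    using time_C1_bounded[OF f K(1)] by blast
  have int: "set_integrable lborel U (f s)" if "s \<in> {0..T}" for s
    by (rule set_integrable_compact_subset[OF K time_C1_continuous_on(1)[OF f that]])
  have int': "set_integrable lborel U (f' t)"
    by (rule set_integrable_compact_subset[OF K time_C1_continuous_on(2)[OF f t]])
  have deriv: "((\<lambda>s. f s x) has_real_derivative f' s x) (at s within {0..T})"
    if "s \<in> {0..T}" "x \<in> U" for s x
    using f that K(2) unfolding time_C1_def by blast
  have lip: "\<bar>f s x - f t x\<bar> \<le> M * \<bar>s - t\<bar>" if "s \<in> {0..T}" "x \<in> U" for s x
    using field_differentiable_bound[of "{0..T}" "\<lambda>s. f s x" "\<lambda>s. f' s x" M s t] deriv M(2) that t K(2)
    by auto
  show ?thesis
    unfolding has_field_derivative_iff tendsto_at_iff_sequentially comp_def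
  proof (intro allI impI)
    fix X :: "nat \<Rightarrow> real"
    assume X: "\<forall>i. X i \<in> {0..T} - {t}" "X \<longlonglongrightarrow> t"
    let ?q = "\<lambda>n x. (f (X n) x - f t x) / (X n - t)"
    have 1: "(\<lambda>n. LINT x:U|lborel. ?q n x) \<longlonglongrightarrow> (LINT x:U|lborel. f' t x)"
      unfolding set_lebesgue_integral_def
    proof (rule integral_dominated_convergence[where w="\<lambda>x. indicator U x *\<^sub>R M"])
      show "(\<lambda>x. indicator U x *\<^sub>R f' t x) \<in> borel_measurable lborel"
        using int' unfolding set_integrable_def by (rule borel_measurable_integrable)
      have "set_integrable lborel U (?q n)" for n
        using X(1) int[of "X n"] int[OF t] by (intro set_integrable_divide set_integral_diff(1)) auto
      then show "(\<lambda>x. indicator U x *\<^sub>R ?q n x) \<in> borel_measurable lborel" for n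
        unfolding set_integrable_def by (rule borel_measurable_integrable)
      show "integrable lborel (\<lambda>x. indicator U x *\<^sub>R M)"
        using set_integrable_compact_subset[OF K continuous_on_const] by (simp add: set_integrable_def)
      show "AE x in lborel. (\<lambda>n. indicator U x *\<^sub>R ?q n x) \<longlonglongrightarrow> indicator U x *\<^sub>R f' t x"
      proof (rule AE_I2)
        fix x
        show "(\<lambda>n. indicator U x *\<^sub>R ?q n x) \<longlonglongrightarrow> indicator U x *\<^sub>R f' t x"
          using deriv[OF t, of x] X
          unfolding has_field_derivative_iff tendsto_at_iff_sequentially comp_def
          by (cases "x \<in> U") auto
      qed
      show "AE x in lborel. norm (indicator U x *\<^sub>R ?q n x) \<le> indicator U x *\<^sub>R M" for n
      proof (rule AE_I2)
        fix x
        have "\<bar>X n - t\<bar> > 0" "X n \<in> {0..T}" using X(1) by auto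
        then show "norm (indicator U x *\<^sub>R ?q n x) \<le> indicator U x *\<^sub>R M"
          using lip[of "X n" x] by (auto simp: indicator_def divide_le_eq)
      qed
    qed
    have 2: "(LINT x:U|lborel. ?q n x) =
        ((LINT x:U|lborel. f (X n) x) - (LINT x:U|lborel. f t x)) / (X n - t)" for n
      using X(1) int[of "X n"] int[OF t] by (simp add: set_integral_diff)
    show "(\<lambda>n. ((LINT x:U|lborel. f (X n) x) - (LINT x:U|lborel. f t x)) / (X n - t))
        \<longlonglongrightarrow> (LINT x:U|lborel. f' t x)"
      using 1 unfolding 2 .
  qed
qed

text \<open>The function \<open>exp (- C * t) * F t\<close> is nonincreasing.\<close>

lemma gronwall_nonpos:
  fixes F :: "real \<Rightarrow> real"
  assumes deriv: "\<And>t. t \<in> {0..T} \<Longrightarrow> (F has_real_derivative D t) (at t within {0..T})"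
    and le: "\<And>t. t \<in> {0..T} \<Longrightarrow> D t \<le> C * F t"
    and 0: "F 0 = 0" and t: "t \<in> {0..T}"
  shows "F t \<le> 0"
proof -
  let ?G = "\<lambda>s. exp (- C * s) * F s"
  have G: "(?G has_real_derivative exp (- C * s) * (D s - C * F s)) (at s within {0..T})"
    if "s \<in> {0..T}" for s
    by (rule derivative_eq_intros deriv[OF that] refl)+ (simp add: algebra_simps)
  have "?G t \<le> ?G 0"
  proof (rule DERIV_nonpos_imp_decreasing_open[where f="?G"])
    show "0 \<le> t" using t by simp
    show "\<exists>y. (?G has_real_derivative y) (at s) \<and> y \<le> 0" if "0 < s" "s < t" for s
    proof -
      have s: "s \<in> {0..T}" "s \<in> interior {0..T}" using that t by auto
      have "(?G has_real_derivative exp (- C * s) * (D s - C * F s)) (at s)"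
        using G[OF s(1)] by (simp only: at_within_interior[OF s(2)])
      then show ?thesis
        using le[OF s(1)] by (auto simp: mult_le_0_iff)
    qed
    have "continuous_on {0..T} ?G"
      using G by (meson DERIV_continuous continuous_on_eq_continuous_within)
    then show "continuous_on {0..t} ?G"
      by (rule continuous_on_subset) (use t in auto)
  qed
  then show ?thesis using 0 by (simp add: mult_le_0_iff)
qed

text \<open>The analytic core. Here \<open>-\<sigma>\<close> is the time derivative of \<open>\<eta>\<close>. When \<open>P\<close> is differentiated instead, the
  result is bounded by a multiple of \<open>\<Sum>\<^sub>i \<eta>\<^sub>i\<^sup>2\<close>, and coercivity of \<open>P\<close> turns this into a multiple of the
  energy density.\<close>

lemma energy_derivative_le:
  fixes P :: "'i::finite \<Rightarrow> 'i \<Rightarrow> real \<Rightarrow> 'a::euclidean_space \<Rightarrow> real"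
  assumes P: "\<And>i j. \<exists>P'. time_C1 T K (P i j) P'"
    and sym: "\<And>i j t x. t \<in> {0..T} \<Longrightarrow> x \<in> K \<Longrightarrow> P i j t x = P j i t x"
    and pos: "\<And>t x. t \<in> {0..T} \<Longrightarrow> x \<in> K \<Longrightarrow> pos_def (\<lambda>i j. P i j t x)"
    and \<eta>: "\<And>i. time_C1 T K (\<eta> i) (\<lambda>t x. - \<sigma> i t x)"
    and K: "compact K" "U \<subseteq> K" "U \<in> sets borel"
  shows "\<exists>C\<ge>0. \<forall>t\<in>{0..T}. \<exists>D.
    ((\<lambda>s. LINT x:U|lborel. qform (\<lambda>i j. P i j s x) (\<lambda>i. \<eta> i s x)) has_real_derivative D) (at t within {0..T}) \<and>
    D \<le> C * (LINT x:U|lborel. qform (\<lambda>i j. P i j t x) (\<lambda>i. \<eta> i t x))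
        - 2 * (LINT x:U|lborel. \<Sum>i\<in>UNIV. \<Sum>j\<in>UNIV. P i j t x * \<eta> i t x * \<sigma> j t x)"
proof -
  obtain P' where P': "\<And>i j. time_C1 T K (P i j) (P' i j)"
    using P by metis
  let ?q = "\<lambda>t x. qform (\<lambda>i j. P i j t x) (\<lambda>i. \<eta> i t x)"
  let ?r = "\<lambda>t x. \<Sum>i\<in>UNIV. \<Sum>j\<in>UNIV. P i j t x * \<eta> i t x * \<sigma> j t x"
  let ?q' = "\<lambda>t x. \<Sum>i\<in>UNIV. \<Sum>j\<in>UNIV. (P' i j t x * \<eta> i t x + P i j t x * - \<sigma> i t x) * \<eta> j t x
      + P i j t x * \<eta> i t x * - \<sigma> j t x"
  have q: "time_C1 T K ?q ?q'"
    unfolding qform_def by (intro time_C1_sum time_C1_mult P' \<eta> finite)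
  \<comment> \<open>The symmetry of \<open>P\<close> merges the two terms in which \<open>\<eta>\<close> is differentiated.\<close>
  have split: "?q' t x = qform (\<lambda>i j. P' i j t x) (\<lambda>i. \<eta> i t x) - 2 * ?r t x"
    if "t \<in> {0..T}" "x \<in> K" for t x
  proof -
    have "(\<Sum>i\<in>UNIV. \<Sum>j\<in>UNIV. P i j t x * \<sigma> i t x * \<eta> j t x) = ?r t x"
      by (subst sum.swap) (simp add: sym[OF that] mult_ac)
    then show ?thesis
      by (simp add: qform_def sum.distrib sum_subtractf sum_negf algebra_simps)
  qed
  have "\<exists>c>0. \<forall>z\<in>{0..T} \<times> K. \<forall>f. c * (\<Sum>i\<in>UNIV. (f i)\<^sup>2) \<le> qform (\<lambda>i j. P i j (fst z) (snd z)) f"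
    using P' K(1) pos unfolding time_C1_def
    by (intro uniform_coercivity compact_Times) auto
  then obtain c where c: "c > 0"
    "\<And>t x f. t \<in> {0..T} \<Longrightarrow> x \<in> K \<Longrightarrow> c * (\<Sum>i\<in>UNIV. (f i)\<^sup>2) \<le> qform (\<lambda>i j. P i j t x) f"
    by force
  obtain m where m: "\<And>i j. 0 \<le> m i j" "\<And>i j t x. t \<in> {0..T} \<Longrightarrow> x \<in> K \<Longrightarrow> \<bar>P' i j t x\<bar> \<le> m i j"
    using time_C1_bounded[OF P' K(1)] by metis
  define M where "M = (\<Sum>i\<in>UNIV. \<Sum>j\<in>UNIV. m i j)"
  have "m i j \<le> M" for i j
    unfolding M_def using m(1)
    by (meson finite UNIV_I member_le_sum order_trans sum_nonneg)
  then have M: "\<bar>P' i j t x\<bar> \<le> M" if "t \<in> {0..T}" "x \<in> K" for i j t x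
    using m(2)[OF that] order_trans by blast
  have "0 \<le> M" unfolding M_def using m(1) by (intro sum_nonneg) auto
  define C where "C = M * CARD('i) / c"
  have "0 \<le> C" using \<open>0 \<le> M\<close> c(1) by (simp add: C_def)
  have le: "?q' t x \<le> C * ?q t x - 2 * ?r t x" if tx: "t \<in> {0..T}" "x \<in> K" for t x
  proof -
    have "qform (\<lambda>i j. P' i j t x) (\<lambda>i. \<eta> i t x) \<le> M * CARD('i) * (\<Sum>i\<in>UNIV. (\<eta> i t x)\<^sup>2)"
      by (rule qform_le_sum_squares) (rule M[OF tx])
    also have "\<dots> = C * (c * (\<Sum>i\<in>UNIV. (\<eta> i t x)\<^sup>2))"
      using c(1) by (simp add: C_def)
    also have "\<dots> \<le> C * ?q t x"
      by (rule mult_left_mono[OF c(2)[OF tx] \<open>0 \<le> C\<close>])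
    finally show ?thesis unfolding split[OF tx] by simp
  qed
  have "\<exists>D. ((\<lambda>s. LINT x:U|lborel. ?q s x) has_real_derivative D) (at t within {0..T}) \<and>
      D \<le> C * (LINT x:U|lborel. ?q t x) - 2 * (LINT x:U|lborel. ?r t x)" if t: "t \<in> {0..T}" for t
  proof -
    have "continuous_on K (\<lambda>x. - (- \<sigma> j t x))" for j
      by (intro continuous_on_minus time_C1_continuous_on(2)[OF \<eta> t])
    then have "continuous_on K (?r t)"
      by (intro continuous_on_sum continuous_on_mult time_C1_continuous_on(1)[OF P' t]
          time_C1_continuous_on(1)[OF \<eta> t]) simp
    note int = set_integrable_compact_subset[OF K this]
      set_integrable_compact_subset[OF K time_C1_continuous_on(1)[OF q t]]
      set_integrable_compact_subset[OF K time_C1_continuous_on(2)[OF q t]]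
    have "(LINT x:U|lborel. ?q' t x) \<le> (LINT x:U|lborel. C * ?q t x - 2 * ?r t x)"
      using int le[OF t] K(2)
      by (intro set_integral_mono set_integral_diff set_integrable_mult_right) auto
    also have "\<dots> = C * (LINT x:U|lborel. ?q t x) - 2 * (LINT x:U|lborel. ?r t x)"
      using int by (subst set_integral_diff(2)) auto
    finally show ?thesis
      using set_integral_time_derivative[OF q K t] by blast
  qed
  then show ?thesis using \<open>0 \<le> C\<close> by blast
qed

section \<open>Charts and partitions\<close>

lemma chart_image_compact:
  assumes "is_chart c" "compact K" "K \<subseteq> chart_dom c"
  shows "compact (crd c ` K)"
  using assms unfolding is_chart_def homeomorphism_def
  by (meson compact_continuous_image continuous_on_subset)

lemma inv_crd_crd: "is_chart c \<Longrightarrow> p \<in> chart_dom c \<Longrightarrow> inv_crd c (crd c p) = p"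
  unfolding is_chart_def homeomorphism_def by blast

lemma crd_inv_crd: "is_chart c \<Longrightarrow> x \<in> crd c ` chart_dom c \<Longrightarrow> crd c (inv_crd c x) = x"
  unfolding is_chart_def homeomorphism_def by blast

lemma chart_image_open:
  assumes c: "is_chart c" and V: "open V" "V \<subseteq> chart_dom c"
  shows "open (crd c ` V)"
proof -
  let ?U = "crd c ` chart_dom c"
  have "crd c ` V = inv_crd c -` V \<inter> ?U"
    using V(2) inv_crd_crd[OF c] crd_inv_crd[OF c] by (auto simp: subset_eq)
  moreover have "continuous_on ?U (inv_crd c)" "open ?U"
    using c unfolding is_chart_def homeomorphism_def by auto
  ultimately show ?thesis
    using continuous_on_open_vimage V(1) by metis
qed

lemma chart_image_borel:
  fixes c :: "('m::topological_space, 'k::finite) chart"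
  assumes c: "is_chart c" and E: "E \<in> sets borel" "E \<subseteq> chart_dom c"
  shows "crd c ` E \<in> sets borel"
proof -
  let ?U = "crd c ` chart_dom c"
  have U: "open ?U" "continuous_on ?U (inv_crd c)"
    using c unfolding is_chart_def homeomorphism_def by auto
  have "inv_crd c \<in> measurable (restrict_space borel ?U) borel"
    by (rule borel_measurable_continuous_on_restrict[OF U(2)])
  then have "inv_crd c -` E \<inter> space (restrict_space borel ?U) \<in> sets (restrict_space borel ?U)"
    using E(1) by (rule measurable_sets)
  moreover have "inv_crd c -` E \<inter> space (restrict_space borel ?U) = crd c ` E"
    using E(2) inv_crd_crd[OF c] crd_inv_crd[OF c]
    by (auto simp: subset_eq space_restrict_space)
  ultimately show ?thesis
    using U(1) by (auto simp: sets_restrict_space_iff)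
qed

lemma chart_compact_neighbourhood:
  fixes c :: "('m::topological_space, 'k::finite) chart"
  assumes c: "is_chart c" and p: "p \<in> chart_dom c"
  shows "\<exists>V K. open V \<and> p \<in> V \<and> V \<subseteq> K \<and> compact K \<and> K \<subseteq> chart_dom c"
proof -
  let ?U = "crd c ` chart_dom c"
  have U: "open ?U" "continuous_on ?U (inv_crd c)" "continuous_on (chart_dom c) (crd c)" "open (chart_dom c)"
    using c unfolding is_chart_def homeomorphism_def by auto
  obtain r where r: "r > 0" "cball (crd c p) r \<subseteq> ?U"
    using U(1) p open_contains_cball by blast
  let ?V = "crd c -` ball (crd c p) r \<inter> chart_dom c" and ?K = "inv_crd c ` cball (crd c p) r"
  have "open ?V"
    using continuous_on_open_vimage[OF U(4)] U(3) by blast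
  moreover have "p \<in> ?V" using p r by simp
  moreover have "?V \<subseteq> ?K"
  proof
    fix q assume "q \<in> ?V"
    then show "q \<in> ?K"
      using inv_crd_crd[OF c, of q] by (intro image_eqI[of _ _ "crd c q"]) (auto simp: less_imp_le)
  qed
  moreover have "compact ?K"
    by (rule compact_continuous_image[OF continuous_on_subset[OF U(2) r(2)] compact_cball])
  moreover have "?K \<subseteq> chart_dom c"
    using r(2) inv_crd_crd[OF c] by (auto simp: subset_eq)
  ultimately show ?thesis by blast
qed

lemma disjointed_borel_pieces:
  assumes "finite F" and "\<And>c. c \<in> F \<Longrightarrow> K c \<in> sets borel"
  shows "\<exists>E. (\<forall>c\<in>F. E c \<in> sets borel \<and> E c \<subseteq> K c) \<and> disjoint_family_on E F \<and> (\<Union>c\<in>F. E c) = (\<Union>c\<in>F. K c)"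
  using assms
proof (induction F rule: finite_induct)
  case empty
  then show ?case by (auto simp: disjoint_family_on_def)
next
  case (insert c F)
  then obtain E where E: "\<forall>c\<in>F. E c \<in> sets borel \<and> E c \<subseteq> K c" "disjoint_family_on E F"
    "(\<Union>c\<in>F. E c) = (\<Union>c\<in>F. K c)" by auto
  let ?E = "E(c := K c - (\<Union>c\<in>F. K c))"
  have same: "?E d = E d" if "d \<in> F" for d using that insert.hyps by auto
  have "(\<Union>c\<in>F. K c) \<in> sets borel" using insert by (intro sets.finite_UN) auto
  then have "\<forall>d\<in>insert c F. ?E d \<in> sets borel \<and> ?E d \<subseteq> K d"
    using E(1) insert.prems by auto
  moreover have "disjoint_family_on ?E (insert c F)"
    using E insert.hyps unfolding disjoint_family_on_def by auto
  moreover have "(\<Union>d\<in>insert c F. ?E d) = (\<Union>d\<in>insert c F. K d)"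
  proof -
    have "(\<Union>d\<in>F. ?E d) = (\<Union>d\<in>F. E d)"
      by (rule SUP_cong[OF refl same])
    then show ?thesis unfolding UN_insert E(3) by auto
  qed
  ultimately show ?case by blast
qed

text \<open>Finitely many compact coordinate neighbourhoods cover the manifold. Those belonging to the same chart
  are merged, because a partition has a single piece for each chart, and then made disjoint.\<close>

lemma chart_partition_exists:
  fixes A :: "('m::t2_space, 'k::finite) chart set"
  assumes A: "smooth_atlas A" and cpt: "compact (UNIV :: 'm set)"
  shows "\<exists>F E. chart_partition A F E"
proof -
  have "\<exists>c V K. c \<in> A \<and> open V \<and> p \<in> V \<and> V \<subseteq> K \<and> compact K \<and> K \<subseteq> chart_dom c" for p :: 'm
  proof -
    obtain c where "c \<in> A" "p \<in> chart_dom c" using A unfolding smooth_atlas_def by blast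
    then show ?thesis
      using chart_compact_neighbourhood[of c p] A unfolding smooth_atlas_def by blast
  qed
  then obtain C V K where CVK: "\<And>p. C p \<in> A" "\<And>p. open (V p)" "\<And>p::'m. p \<in> V p" "\<And>p. V p \<subseteq> K p"
    "\<And>p. compact (K p)" "\<And>p. K p \<subseteq> chart_dom (C p)"
    by metis
  obtain P where P: "finite P" "UNIV \<subseteq> (\<Union>p\<in>P. V p)"
    using compactE_image[OF cpt, of UNIV V] CVK(2,3) by (metis UNIV_I UN_I subsetI)
  define L where "L c = (\<Union>p\<in>{p\<in>P. C p = c}. K p)" for c
  have L: "compact (L c)" "L c \<subseteq> chart_dom c" for c
    unfolding L_def using P(1) CVK(5,6) by (auto intro!: compact_UN)
  have "\<exists>E. (\<forall>c\<in>C ` P. E c \<in> sets borel \<and> E c \<subseteq> L c) \<and> disjoint_family_on E (C ` P) \<and>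
      (\<Union>c\<in>C ` P. E c) = (\<Union>c\<in>C ` P. L c)"
    by (rule disjointed_borel_pieces) (use P L in \<open>auto intro!: borel_closed compact_imp_closed\<close>)
  then obtain E where E: "\<forall>c\<in>C ` P. E c \<in> sets borel \<and> E c \<subseteq> L c" "disjoint_family_on E (C ` P)"
    "(\<Union>c\<in>C ` P. E c) = (\<Union>c\<in>C ` P. L c)" by blast
  have "(\<Union>c\<in>C ` P. L c) = UNIV"
  proof -
    have "q \<in> (\<Union>c\<in>C ` P. L c)" for q
    proof -
      obtain p where "p \<in> P" "q \<in> V p" using P(2) by blast
      then show ?thesis using CVK(4)[of p] unfolding L_def by blast
    qed
    then show ?thesis by blast
  qed
  then have "(\<Union>c\<in>C ` P. E c) = UNIV" using E(3) by simp
  moreover have "E c \<in> sets borel \<and> (\<exists>K. compact K \<and> E c \<subseteq> K \<and> K \<subseteq> chart_dom c)" if "c \<in> C ` P" for c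
    using E(1) L that by (intro conjI exI[of _ "L c"]) auto
  moreover have "finite (C ` P)" "C ` P \<subseteq> A" using P(1) CVK(1) by auto
  ultimately have "chart_partition A (C ` P) E"
    unfolding chart_partition_def using E(2) by (intro conjI ballI) simp_all
  then show ?thesis by blast
qed

text \<open>The choice operator in the definition of the integral involves neither the metric nor the
  integrand, so one partition serves all integrals.\<close>

lemma integral_vol_partition:
  fixes A :: "('m::t2_space, 'k::finite) chart set"
  assumes "smooth_atlas A" and "compact (UNIV :: 'm set)"
  obtains F E where "chart_partition A F E"
    and "\<And>g f. integral_vol A g f =
      (\<Sum>c\<in>F. LINT x:(crd c ` E c)|lborel. f c (inv_crd c x) * sqrt (det (g c (inv_crd c x))))"
proof -
  let ?P = "\<lambda>(F, E). chart_partition A F E"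
  obtain F E where FE: "(SOME z. ?P z) = (F, E)" by fastforce
  have "?P (SOME z. ?P z)"
    by (rule someI_ex) (use chart_partition_exists[OF assms] in auto)
  then have "chart_partition A F E" by (simp add: FE)
  then show ?thesis
    by (rule that) (simp add: integral_vol_def FE)
qed

text \<open>The pieces of a partition need not have interior points, so a set that is null in every piece is
  first transported to a single chart, where an open set that is a finite union of null sets is empty.\<close>

lemma chart_cover_null_imp_empty:
  fixes A :: "('m::t2_space, 'k::finite) chart set"
  assumes A: "smooth_atlas A" and F: "finite F" "F \<subseteq> A" "(\<Union>c\<in>F. E c) = UNIV"
    and V: "open V" and null: "\<And>c. c \<in> F \<Longrightarrow> E c \<subseteq> chart_dom c \<and> negligible (crd c ` (E c \<inter> V))"
  shows "V = {}"
proof (rule ccontr)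
  assume "V \<noteq> {}"
  then obtain p where "p \<in> V" by blast
  obtain c where c: "c \<in> A" "p \<in> chart_dom c" using A unfolding smooth_atlas_def by blast
  have chart: "is_chart d" if "d \<in> A" for d using A that unfolding smooth_atlas_def by blast
  have "negligible (crd c ` (V \<inter> chart_dom c \<inter> E d))" if d: "d \<in> F" for d
  proof -
    let ?f = "\<lambda>x. crd c (inv_crd d x)"
    let ?S = "crd d ` (V \<inter> chart_dom c \<inter> E d)"
    have Ed: "E d \<subseteq> chart_dom d" "is_chart d" "d \<in> A" using null[OF d] d F(2) chart[of d] by blast+
    have "smooth_on (crd d ` (chart_dom d \<inter> chart_dom c)) ?f"
      using A Ed c unfolding smooth_atlas_def by blast
    then have "Ck_on (Suc 0) (crd d ` (chart_dom d \<inter> chart_dom c)) ?f"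
      unfolding smooth_on_def by blast
    then have "?f differentiable_on crd d ` (chart_dom d \<inter> chart_dom c)"
      by (simp add: differentiable_on_def)
    then have "?f differentiable_on ?S"
      by (rule differentiable_on_subset) (use Ed in auto)
    moreover have "negligible ?S"
      by (rule negligible_subset[of "crd d ` (E d \<inter> V)"]) (use null[OF d] in auto)
    \<comment> \<open>transition maps are differentiable, hence preserve null sets\<close>
    ultimately have "negligible (?f ` ?S)"
      by (intro negligible_differentiable_image_negligible) auto
    moreover have "?f ` ?S = crd c ` (V \<inter> chart_dom c \<inter> E d)"
      unfolding image_image using Ed inv_crd_crd[OF Ed(2)] by (intro image_cong) auto
    ultimately show ?thesis by simp
  qed
  then have "negligible (\<Union>d\<in>F. crd c ` (V \<inter> chart_dom c \<inter> E d))"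
    using F(1) by (intro negligible_Union) auto
  moreover have "(\<Union>d\<in>F. crd c ` (V \<inter> chart_dom c \<inter> E d)) = crd c ` (V \<inter> chart_dom c)"
    unfolding image_UN[symmetric] Int_UN_distrib[symmetric] F(3) by simp
  moreover have "open (crd c ` (V \<inter> chart_dom c))"
    using chart[OF c(1)] V by (intro chart_image_open) (auto simp: is_chart_def)
  ultimately show False
    using open_not_negligible \<open>p \<in> V\<close> c(2) by fastforce
qed

section \<open>Smooth tensor fields\<close>

lemma has_derivative_cong_on:
  assumes "x \<in> S" "\<And>y. y \<in> S \<Longrightarrow> f y = g y"
  shows "(f has_derivative D) (at x within S) \<longleftrightarrow> (g has_derivative D) (at x within S)"
proof
  show "(g has_derivative D) (at x within S)" if "(f has_derivative D) (at x within S)"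
    by (rule has_derivative_transform[OF assms(1) _ that]) (simp add: assms(2))
  show "(f has_derivative D) (at x within S)" if "(g has_derivative D) (at x within S)"
    by (rule has_derivative_transform[OF assms(1) _ that]) (simp add: assms(2))
qed

lemma frechet_derivative_cong_on:
  assumes "x \<in> S" "\<And>y. y \<in> S \<Longrightarrow> f y = g y"
  shows "frechet_derivative f (at x within S) = frechet_derivative g (at x within S)"
proof -
  have "(\<lambda>D. (f has_derivative D) (at x within S)) = (\<lambda>D. (g has_derivative D) (at x within S))"
    by (rule ext, rule has_derivative_cong_on[OF assms])
  then show ?thesis
    unfolding frechet_derivative_def by (rule arg_cong)
qed

lemma Ck_on_cong:
  "(\<And>x. x \<in> S \<Longrightarrow> f x = g x) \<Longrightarrow> Ck_on k S f \<Longrightarrow> Ck_on k S g"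
proof (induction k arbitrary: f g)
  case 0
  then show ?case using continuous_on_cong[of S S f g] by simp
next
  case (Suc k)
  have "g differentiable (at x within S)" if "x \<in> S" for x
    using Suc.prems(2) that has_derivative_cong_on[of x S f g] Suc.prems(1)
    unfolding Ck_on.simps differentiable_def by metis
  moreover have "Ck_on k S (\<lambda>x. frechet_derivative g (at x within S) v)" for v
    by (rule Suc.IH[of "\<lambda>x. frechet_derivative f (at x within S) v"])
       (use Suc.prems frechet_derivative_cong_on[of _ S f g] in auto)
  ultimately show ?case by simp
qed

text \<open>Openness of \<open>S\<close> makes derivatives within \<open>S\<close> unique, so that the chosen Frechet derivative of the
  difference is the difference of the chosen derivatives.\<close>

lemma Ck_on_diff:
  assumes S: "open S"
  shows "Ck_on k S f \<Longrightarrow> Ck_on k S g \<Longrightarrow> Ck_on k S (\<lambda>x. f x - g x)"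
proof (induction k arbitrary: f g)
  case 0
  then show ?case by (simp add: continuous_on_diff)
next
  case (Suc k)
  have D: "((\<lambda>x. f x - g x) has_derivative
      (\<lambda>v. frechet_derivative f (at x within S) v - frechet_derivative g (at x within S) v)) (at x within S)"
    if "x \<in> S" for x
    using Suc.prems that by (auto intro!: has_derivative_diff simp: frechet_derivative_works[symmetric])
  have "Ck_on k S (\<lambda>x. frechet_derivative (\<lambda>x. f x - g x) (at x within S) v)" for v
  proof (rule Ck_on_cong)
    show "Ck_on k S (\<lambda>x. frechet_derivative f (at x within S) v - frechet_derivative g (at x within S) v)"
      using Suc by auto
    show "frechet_derivative f (at x within S) v - frechet_derivative g (at x within S) v =
        frechet_derivative (\<lambda>x. f x - g x) (at x within S) v" if "x \<in> S" for x
      using frechet_derivative_at[OF D[OF that, unfolded at_within_open[OF that S]]]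
      unfolding at_within_open[OF that S] by (rule fun_cong)
  qed
  moreover have "(\<lambda>x. f x - g x) differentiable (at x within S)" if "x \<in> S" for x
    using D[OF that] unfolding differentiable_def by blast
  ultimately show ?case by simp
qed

lemma open_chart_image: "is_chart c \<Longrightarrow> open (crd c ` chart_dom c)"
  by (simp add: is_chart_def)

text \<open>Fields carry meaning only inside the chart domain, so whatever is derived from them must not depend
  on their values elsewhere. Partial derivatives do not, because they are local and the domain is open.\<close>

lemma pderiv_cong:
  assumes c: "is_chart c" and p: "p \<in> chart_dom c" and eq: "\<And>q. q \<in> chart_dom c \<Longrightarrow> f q = g q"
  shows "pderiv c i f p = pderiv c i g p"
proof -
  have "f (inv_crd c x) = g (inv_crd c x)" if "x \<in> crd c ` chart_dom c" for x
    using that inv_crd_crd[OF c] by (auto intro: eq)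
  then show ?thesis
    unfolding pderiv_def
    using frechet_derivative_cong_on[of "crd c p" "crd c ` chart_dom c" "\<lambda>x. f (inv_crd c x)" "\<lambda>x. g (inv_crd c x)"]
      at_within_open[OF imageI[OF p] open_chart_image[OF c]] p
    by simp
qed

lemma smooth_tensor2_entry_differentiable:
  assumes sm: "smooth_tensor2 A \<alpha>" and c: "c \<in> A" "is_chart c" and p: "p \<in> chart_dom c"
  shows "(\<lambda>x. \<alpha> c (inv_crd c x) $ i $ j) differentiable (at (crd c p))"
proof -
  have "Ck_on (Suc 0) (crd c ` chart_dom c) (\<lambda>x. \<alpha> c (inv_crd c x))"
    using sm c(1) unfolding smooth_tensor2_def smooth_on_def by blast
  then have "(\<lambda>x. \<alpha> c (inv_crd c x)) differentiable (at (crd c p))"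
    using p at_within_open[OF imageI[OF p] open_chart_image[OF c(2)]] by force
  then obtain D where "((\<lambda>x. \<alpha> c (inv_crd c x)) has_derivative D) (at (crd c p))"
    unfolding differentiable_def by blast
  then have "((\<lambda>x. \<alpha> c (inv_crd c x) $ i $ j) has_derivative (\<lambda>h. D h $ i $ j)) (at (crd c p))"
    by (intro bounded_linear.has_derivative[OF bounded_linear_vec_nth])
  then show ?thesis unfolding differentiable_def by blast
qed

lemma ext_deriv_diff:
  assumes sm: "smooth_tensor2 A \<alpha>" "smooth_tensor2 A \<beta>" and c: "c \<in> A" "is_chart c" and p: "p \<in> chart_dom c"
  shows "ext_deriv (\<lambda>c p. \<alpha> c p - \<beta> c p) c p = ext_deriv \<alpha> c p - ext_deriv \<beta> c p"
proof -
  have "pderiv c i (\<lambda>q. (\<alpha> c q - \<beta> c q) $ j $ k) p =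
      pderiv c i (\<lambda>q. \<alpha> c q $ j $ k) p - pderiv c i (\<lambda>q. \<beta> c q $ j $ k) p" for i j k
  proof -
    have "((\<lambda>x. \<alpha> c (inv_crd c x) $ j $ k - \<beta> c (inv_crd c x) $ j $ k) has_derivative
       (\<lambda>v. frechet_derivative (\<lambda>x. \<alpha> c (inv_crd c x) $ j $ k) (at (crd c p)) v
         - frechet_derivative (\<lambda>x. \<beta> c (inv_crd c x) $ j $ k) (at (crd c p)) v)) (at (crd c p))"
      using smooth_tensor2_entry_differentiable[OF _ c p] sm
      by (intro has_derivative_diff) (simp_all add: frechet_derivative_works[symmetric])
    from frechet_derivative_at[OF this] show ?thesis
      unfolding pderiv_def by (simp add: fun_eq_iff)
  qed
  then show ?thesis
    unfolding ext_deriv_def by (simp add: vec_eq_iff)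
qed

lemma two_form_diff:
  assumes A: "smooth_atlas A" and \<alpha>: "two_form A \<alpha>" and \<beta>: "two_form A \<beta>"
  shows "two_form A (\<lambda>c p. \<alpha> c p - \<beta> c p)"
proof -
  have "open (crd c ` chart_dom c)" if "c \<in> A" for c
    using A that open_chart_image unfolding smooth_atlas_def by blast
  then have "smooth_tensor2 A (\<lambda>c p. \<alpha> c p - \<beta> c p)"
    using \<alpha> \<beta> Ck_on_diff unfolding two_form_def smooth_tensor2_def smooth_on_def by blast
  moreover have bil: "bil (a - b) x y = bil a x y - bil b x y" for a b :: "real^'b^'b" and x y
    by (simp add: matrix_vector_mult_diff_rdistrib inner_diff_right)
  have "bilinear_form_field A (\<lambda>c p. \<alpha> c p - \<beta> c p)"
    using \<alpha> \<beta> unfolding two_form_def bilinear_form_field_def bil by metis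
  moreover have "\<forall>c\<in>A. \<forall>p\<in>chart_dom c. \<forall>x y. bil (\<alpha> c p - \<beta> c p) x y = - bil (\<alpha> c p - \<beta> c p) y x"
  proof (intro ballI allI)
    fix c p and x y :: "real^'b"
    assume cp: "c \<in> A" "p \<in> chart_dom c"
    have "bil (\<alpha> c p) x y = - bil (\<alpha> c p) y x" "bil (\<beta> c p) x y = - bil (\<beta> c p) y x"
      using \<alpha> \<beta> cp unfolding two_form_def by blast+
    then show "bil (\<alpha> c p - \<beta> c p) x y = - bil (\<alpha> c p - \<beta> c p) y x"
      unfolding bil by linarith
  qed
  ultimately show ?thesis unfolding two_form_def by blast
qed

lemma bilinear_form_field_eq_0:
  assumes b: "bilinear_form_field A \<alpha>" and "c \<in> A" "c' \<in> A" "p \<in> chart_dom c" "p \<in> chart_dom c'" and "\<alpha> c' p = 0"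
  shows "\<alpha> c p = 0"
proof -
  have "bil (\<alpha> c p) x y = bil (\<alpha> c' p) (jac c c' p *v x) (jac c c' p *v y)" for x y
    using assms(1-5) unfolding bilinear_form_field_def by blast
  then have "\<alpha> c p $ i $ j = 0" for i j
    using bil_axis[of i "\<alpha> c p" j] by (simp add: assms(6))
  then show ?thesis by (simp add: vec_eq_iff)
qed

lemma two_form_nonzero_open:
  assumes A: "smooth_atlas A" and \<eta>: "two_form A \<eta>"
  shows "open {p. \<exists>c\<in>A. p \<in> chart_dom c \<and> \<eta> c p \<noteq> 0}"
proof -
  have "open {p \<in> chart_dom c. \<eta> c p \<noteq> 0}" if c: "c \<in> A" for c
  proof -
    have chart: "is_chart c" using A c unfolding smooth_atlas_def by blast
    then have dom: "open (chart_dom c)" "continuous_on (chart_dom c) (crd c)"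
      unfolding is_chart_def homeomorphism_def by auto
    have "Ck_on 0 (crd c ` chart_dom c) (\<lambda>x. \<eta> c (inv_crd c x))"
      using \<eta> c unfolding two_form_def smooth_tensor2_def smooth_on_def by blast
    then have "continuous_on (chart_dom c) (\<lambda>p. \<eta> c (inv_crd c (crd c p)))"
      using continuous_on_compose2[OF _ dom(2)] by auto
    then have "continuous_on (chart_dom c) (\<eta> c)"
      by (rule continuous_on_eq) (simp add: inv_crd_crd[OF chart])
    then have "open (\<eta> c -` (- {0}) \<inter> chart_dom c)"
      using continuous_on_open_vimage[OF dom(1)] by blast
    moreover have "\<eta> c -` (- {0}) \<inter> chart_dom c = {p \<in> chart_dom c. \<eta> c p \<noteq> 0}" by auto
    ultimately show ?thesis by simp
  qed
  moreover have eq: "{p. \<exists>c\<in>A. p \<in> chart_dom c \<and> \<eta> c p \<noteq> 0} = (\<Union>c\<in>A. {p \<in> chart_dom c. \<eta> c p \<noteq> 0})"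
    by auto
  ultimately show ?thesis unfolding eq by (intro open_UN ballI)
qed

lemma ricci_cong:
  assumes c: "is_chart c" and p: "p \<in> chart_dom c" and eq: "\<And>q. q \<in> chart_dom c \<Longrightarrow> g c q = h c q"
  shows "ricci g c p = ricci h c p"
proof -
  have chr: "christoffel g c q l i j = christoffel h c q l i j" if "q \<in> chart_dom c" for q l i j
  proof -
    have "pderiv c i (\<lambda>q. g c q $ j $ m) q = pderiv c i (\<lambda>q. h c q $ j $ m) q" for i j m
      by (rule pderiv_cong[OF c that]) (simp add: eq)
    then show ?thesis
      unfolding christoffel_def ginv_def by (simp add: eq[OF that])
  qed
  have "pderiv c i (\<lambda>q. christoffel g c q l j k) p = pderiv c i (\<lambda>q. christoffel h c q l j k) p" for i j k l
    by (rule pderiv_cong[OF c p]) (rule chr)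
  then show ?thesis
    unfolding ricci_def riemann_def by (simp add: chr[OF p])
qed

lemma B_endo_cong:
  assumes c: "is_chart c" and p: "p \<in> chart_dom c" and eq: "\<And>q. q \<in> chart_dom c \<Longrightarrow> \<omega> c q = \<omega>' c q"
  shows "B_endo \<omega> J c p = B_endo \<omega>' J c p"
proof -
  have "metric \<omega> J c q = metric \<omega>' J c q" if "q \<in> chart_dom c" for q
    using eq[OF that] by (simp add: metric_def)
  from this[OF p] ricci_cong[OF c p, of "metric \<omega> J" "metric \<omega>' J", OF this] show ?thesis
    unfolding B_endo_def by simp
qed

text \<open>The zero matrix satisfies the defining equation, and positivity of the metric makes it the only
  solution.\<close>

lemma K1_eq_0:
  assumes pos: "\<And>x. x \<noteq> 0 \<Longrightarrow> 0 < bil (metric \<omega> J c p) x x" and "\<sigma> c p = 0"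
  shows "K1 \<omega> J \<sigma> c p = 0"
  unfolding K1_def
proof (rule the_equality)
  show "\<forall>x y. bil (metric \<omega> J c p) (0 *v x) y =
     (bil (\<sigma> c p) (J c p *v x) (J c p *v y) - bil (\<sigma> c p) x y) / 2"
    by (simp add: assms(2))
  fix K
  assume K: "\<forall>x y. bil (metric \<omega> J c p) (K *v x) y =
     (bil (\<sigma> c p) (J c p *v x) (J c p *v y) - bil (\<sigma> c p) x y) / 2"
  have "bil (metric \<omega> J c p) (K *v x) (K *v x) = 0" for x
    using K[rule_format, of x "K *v x"] assms(2) by simp
  then have "K *v x = 0" for x
    using pos[of "K *v x"] by force
  then show "K = 0" by (simp add: matrix_eq)
qed

text \<open>The time derivative is the joint derivative evaluated in the direction \<open>(1, 0)\<close>.\<close>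

lemma smooth_family_time_C1:
  assumes sm: "smooth_family A I \<alpha>" and c: "c \<in> A" and K: "K \<subseteq> crd c ` chart_dom c" and T: "{0..T} \<subseteq> I"
  shows "\<exists>f'. time_C1 T K (\<lambda>t x. \<alpha> t c (inv_crd c x) $ i $ j) f'"
proof -
  let ?S = "I \<times> crd c ` chart_dom c"
  let ?F = "\<lambda>(t, x). \<alpha> t c (inv_crd c x)"
  let ?d = "\<lambda>z. frechet_derivative ?F (at z within ?S)"
  have sub: "{0..T} \<times> K \<subseteq> ?S" using K T by auto
  have F: "smooth_on ?S ?F" using sm c unfolding smooth_family_def by blast
  have "Ck_on 0 ?S ?F" "Ck_on (Suc 0) ?S ?F" using F unfolding smooth_on_def by blast+
  then have cont: "continuous_on ?S ?F" and diff: "\<And>z. z \<in> ?S \<Longrightarrow> ?F differentiable (at z within ?S)"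
    and cont': "\<And>v. continuous_on ?S (\<lambda>z. ?d z v)"
    by auto
  let ?f' = "\<lambda>t x. ?d (t, x) (1, 0) $ i $ j"
  have "((\<lambda>s. \<alpha> s c (inv_crd c x) $ i $ j) has_real_derivative ?f' t x) (at t within {0..T})"
    if tx: "t \<in> {0..T}" "x \<in> K" for t x
  proof -
    have z: "(t, x) \<in> ?S" using tx sub by blast
    have D: "(?F has_derivative ?d (t, x)) (at (t, x) within ?S)"
      using diff[OF z] by (simp add: frechet_derivative_works)
    have "((\<lambda>s. (s, x)) has_derivative (\<lambda>h. (h, 0))) (at t within {0..T})"
      by (auto intro!: derivative_eq_intros)
    moreover have "(?F has_derivative ?d (t, x)) (at (t, x) within (\<lambda>s. (s, x)) ` {0..T})"
      by (rule has_derivative_subset[OF D]) (use tx sub in auto)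
    ultimately have "((\<lambda>s. ?F (s, x)) has_derivative (\<lambda>h. ?d (t, x) (h, 0))) (at t within {0..T})"
      by (rule has_derivative_in_compose)
    then have "((\<lambda>s. ?F (s, x) $ i $ j) has_derivative (\<lambda>h. ?d (t, x) (h, 0) $ i $ j)) (at t within {0..T})"
      by (intro bounded_linear.has_derivative[OF bounded_linear_vec_nth])
    moreover have "(\<lambda>h. ?d (t, x) (h, 0) $ i $ j) = (*) (?f' t x)"
    proof
      fix h
      have "?d (t, x) (h *\<^sub>R (1, 0)) = h *\<^sub>R ?d (t, x) (1, 0)"
        by (rule linear_cmul[OF has_derivative_linear[OF D]])
      then have "?d (t, x) (h, 0) $ i $ j = (h *\<^sub>R ?d (t, x) (1, 0)) $ i $ j"
        by (simp only: scaleR_Pair scaleR_zero_right real_scaleR_def mult_1_right)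
      then show "?d (t, x) (h, 0) $ i $ j = ?f' t x * h"
        by (simp only: vector_scaleR_component real_scaleR_def mult.commute)
    qed
    ultimately show ?thesis
      unfolding has_field_derivative_def by (simp only: prod.case)
  qed
  moreover have "continuous_on ({0..T} \<times> K) (\<lambda>z. \<alpha> (fst z) c (inv_crd c (snd z)) $ i $ j)"
    using continuous_on_subset[OF cont sub]
    by (intro continuous_on_component) (simp only: case_prod_unfold)
  moreover have "continuous_on ({0..T} \<times> K) (\<lambda>z. ?f' (fst z) (snd z))"
    using continuous_on_subset[OF cont' sub]
    by (intro continuous_on_component) (simp only: prod.collapse)
  ultimately show ?thesis
    unfolding time_C1_def by (intro exI[of _ ?f'] conjI ballI)
qed

section \<open>Inner products of forms\<close>

text \<open>The coefficients, indexed by pairs of indices, of the inner product of 2-forms in a chart. The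
  volume density is included so that its time derivative is covered by that of the coefficients.\<close>

definition kernel2 :: "('m, 'k::finite) tensor2 \<Rightarrow> ('m, 'k) chart \<Rightarrow> 'm \<Rightarrow> 'k \<times> 'k \<Rightarrow> 'k \<times> 'k \<Rightarrow> real" where
  "kernel2 g c p x y =
    ginv g c p $ fst x $ fst y * ginv g c p $ snd x $ snd y * (sqrt (det (g c p)) / 2)"

lemma inner2_kernel2:
  "inner2 g \<alpha> \<beta> c p * sqrt (det (g c p)) =
    (\<Sum>x\<in>UNIV. \<Sum>y\<in>UNIV. kernel2 g c p x y * \<alpha> c p $ fst x $ snd x * \<beta> c p $ fst y $ snd y)"
proof -
  have "inner2 g \<alpha> \<beta> c p * sqrt (det (g c p)) = (\<Sum>i\<in>UNIV. \<Sum>j\<in>UNIV. \<Sum>a\<in>UNIV. \<Sum>b\<in>UNIV.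
     kernel2 g c p (i, j) (a, b) * \<alpha> c p $ i $ j * \<beta> c p $ a $ b)"
    unfolding inner2_def kernel2_def sum_divide_distrib sum_distrib_right
    by (intro sum.cong refl) simp
  then show ?thesis
    by (simp only: UNIV_Times_UNIV[symmetric] sum.cartesian_product' fst_conv snd_conv)
qed

lemma kernel2_sym:
  assumes g: "pos_def_matrix (g c p)"
  shows "kernel2 g c p x y = kernel2 g c p y x"
proof -
  note h = pos_def_matrix_entries(1)[OF pos_def_matrix_inv[OF g]]
  show ?thesis
    unfolding kernel2_def ginv_def using h[of "fst x" "fst y"] h[of "snd x" "snd y"] by simp
qed

lemma pos_def_kernel2:
  assumes g: "pos_def_matrix (g c p)"
  shows "pos_def (kernel2 g c p)"
proof -
  note h = pos_def_matrix_entries[OF pos_def_matrix_inv[OF g]]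
  have "pos_def (\<lambda>x y. matrix_inv (g c p) $ fst x $ fst y * matrix_inv (g c p) $ snd x $ snd y
      * (sqrt (det (g c p)) / 2))"
    using pos_def_matrix_det_pos[OF g] by (intro pos_def_scale pos_def_tensor[OF h(1) h(2) h(2)]) simp
  then show ?thesis unfolding kernel2_def[abs_def] ginv_def .
qed

text \<open>A 3-tensor is regarded as a vector indexed by triples; its inner product is the threefold tensor
  power of the inverse metric.\<close>

lemma inner3_nonneg:
  assumes g: "pos_def_matrix (g c p)"
  shows "0 \<le> inner3 g \<theta> \<theta> c p"
proof -
  note h = pos_def_matrix_entries[OF pos_def_matrix_inv[OF g]]
  let ?h = "matrix_inv (g c p)"
  let ?k = "\<lambda>x y. ?h $ fst x $ fst y * (?h $ fst (snd x) $ fst (snd y) * ?h $ snd (snd x) $ snd (snd y))"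
  have "pos_def ?k"
    using pos_def_tensor[OF h(1) h(2) pos_def_tensor[OF h(1) h(2) h(2)]] .
  then have "0 \<le> qform ?k (\<lambda>x. \<theta> c p $ fst x $ fst (snd x) $ snd (snd x))"
    by (rule pos_def_nonneg)
  also have "qform ?k (\<lambda>x. \<theta> c p $ fst x $ fst (snd x) $ snd (snd x)) = 6 * inner3 g \<theta> \<theta> c p"
    by (simp only: qform_def UNIV_Times_UNIV[symmetric] sum.cartesian_product' fst_conv snd_conv
        inner3_def ginv_def mult.assoc)
  finally show ?thesis by simp
qed

lemma almost_hermitian_pos_def:
  "almost_hermitian A \<omega> J \<Longrightarrow> c \<in> A \<Longrightarrow> p \<in> chart_dom c \<Longrightarrow> pos_def_matrix (metric \<omega> J c p)"
  unfolding almost_hermitian_def pos_def_matrix_def by blast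

lemma kernel2_time_C1:
  assumes sm: "smooth_family A I \<omega>" "smooth_family A I J" and c: "c \<in> A" "is_chart c"
    and K: "K \<subseteq> crd c ` chart_dom c" and T: "{0..T} \<subseteq> I"
    and ah: "\<And>t. t \<in> I \<Longrightarrow> almost_hermitian A (\<omega> t) (J t)"
  shows "\<exists>P'. time_C1 T K (\<lambda>t x. kernel2 (metric (\<omega> t) (J t)) c (inv_crd c x) u v) P'"
proof -
  let ?g = "\<lambda>t x. metric (\<omega> t) (J t) c (inv_crd c x)"
  have pd: "pos_def_matrix (?g t x)" if "t \<in> {0..T}" "x \<in> K" for t x
    using almost_hermitian_pos_def[OF ah c(1)] that K T inv_crd_crd[OF c(2)] by force
  note det_pos = pos_def_matrix_det_pos[OF pd]
  obtain w' where w': "\<And>i j. time_C1 T K (\<lambda>t x. \<omega> t c (inv_crd c x) $ i $ j) (w' i j)"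
    using smooth_family_time_C1[OF sm(1) c(1) K T] by metis
  obtain j' where j': "\<And>i j. time_C1 T K (\<lambda>t x. J t c (inv_crd c x) $ i $ j) (j' i j)"
    using smooth_family_time_C1[OF sm(2) c(1) K T] by metis
  have g: "\<exists>f'. time_C1 T K (\<lambda>t x. ?g t x $ i $ j) f'" for i j
  proof -
    have eq: "?g t x $ i $ j = (\<Sum>m\<in>UNIV. \<omega> t c (inv_crd c x) $ i $ m * J t c (inv_crd c x) $ m $ j)" for t x
      by (simp add: metric_def matrix_matrix_mult_def)
    show ?thesis
      unfolding eq by (rule exI, rule time_C1_sum[OF finite], rule time_C1_mult[OF w' j'])
  qed
  have nz: "det (?g t x) \<noteq> 0" if "t \<in> {0..T}" "x \<in> K" for t x
    using det_pos[OF that] by simp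
  have h: "\<exists>f'. time_C1 T K (\<lambda>t x. matrix_inv (?g t x) $ i $ j) f'" for i j
    by (intro time_C1_matrix_inv g nz)
  obtain d' where "time_C1 T K (\<lambda>t x. det (?g t x)) d'"
    using time_C1_det[of T K ?g, OF g] by blast
  note d = time_C1_sqrt[OF this det_pos]
  note h' = someI_ex[OF h]
  show ?thesis
    unfolding kernel2_def ginv_def divide_inverse
    by (rule exI, rule time_C1_mult[OF time_C1_mult[OF h' h'] time_C1_mult[OF d time_C1_const]])
qed

section \<open>The energy of the flow\<close>

lemma flow_difference_time_C1:
  assumes sm: "smooth_family A I \<omega>" and c: "c \<in> A" "is_chart c"
    and K: "K \<subseteq> crd c ` chart_dom c" and T: "0 < T" "{0..T} \<subseteq> I"
    and der: "\<And>t. t \<in> I \<Longrightarrow> has_time_derivative A I \<omega> (\<lambda>c p. - \<sigma> t c p) t"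
  shows "time_C1 T K (\<lambda>t x. (\<omega> t c (inv_crd c x) - \<omega> 0 c (inv_crd c x)) $ i $ j)
    (\<lambda>t x. - (\<sigma> t c (inv_crd c x) $ i $ j))"
proof -
  obtain f' where f': "time_C1 T K (\<lambda>t x. \<omega> t c (inv_crd c x) $ i $ j) f'"
    using smooth_family_time_C1[OF sm c(1) K T(2)] by blast
  have "time_C1 T K (\<lambda>t x. \<omega> t c (inv_crd c x) $ i $ j) (\<lambda>t x. - (\<sigma> t c (inv_crd c x) $ i $ j))"
  proof (rule time_C1_cong_deriv[OF f' T(1)])
    fix t x assume tx: "t \<in> {0..T}" "x \<in> K"
    then have "t \<in> I" "inv_crd c x \<in> chart_dom c" using T(2) K inv_crd_crd[OF c(2)] by force+
    then have "((\<lambda>s. \<omega> s c (inv_crd c x)) has_vector_derivative - \<sigma> t c (inv_crd c x)) (at t within {0..T})"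
      using der c(1) T(2) has_vector_derivative_within_subset unfolding has_time_derivative_def by blast
    then have "((\<lambda>s. \<omega> s c (inv_crd c x) $ i $ j) has_vector_derivative (- \<sigma> t c (inv_crd c x)) $ i $ j)
        (at t within {0..T})"
      by (intro bounded_linear.has_vector_derivative[OF bounded_linear_vec_nth])
    then show "((\<lambda>s. \<omega> s c (inv_crd c x) $ i $ j) has_real_derivative - (\<sigma> t c (inv_crd c x) $ i $ j))
        (at t within {0..T})"
      by (simp add: has_real_derivative_iff_has_vector_derivative)
  qed
  moreover have "continuous_on K (\<lambda>x. - (\<omega> 0 c (inv_crd c x) $ i $ j))"
    using time_C1_continuous_on(1)[OF f', of 0] T(1) by (intro continuous_on_minus) simp
  ultimately show ?thesis
    using time_C1_add[OF _ time_C1_time_independent] by fastforce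
qed

text \<open>The energy inequality on one piece \<open>E\<close> of the partition, together with the fact that the energy
  controls \<open>\<eta>\<close>.\<close>

lemma chart_energy:
  fixes A :: "('m::t2_space, 'k::finite) chart set"
  assumes sm: "smooth_family A I \<omega>" "smooth_family A I J" and c: "c \<in> A" "is_chart c"
    and T: "0 < T" "{0..T} \<subseteq> I"
    and ah: "\<And>t. t \<in> I \<Longrightarrow> almost_hermitian A (\<omega> t) (J t)"
    and der: "\<And>t. t \<in> I \<Longrightarrow> has_time_derivative A I \<omega> (\<lambda>c p. - \<sigma> t c p) t"
    and E: "E \<in> sets borel" "compact L" "E \<subseteq> L" "L \<subseteq> chart_dom c"
  defines "g \<equiv> \<lambda>t. metric (\<omega> t) (J t)" and "\<eta> \<equiv> \<lambda>t c p. \<omega> t c p - \<omega> 0 c p"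
  defines "energy \<equiv> \<lambda>t. LINT x:crd c ` E|lborel.
      inner2 (g t) (\<eta> t) (\<eta> t) c (inv_crd c x) * sqrt (det (g t c (inv_crd c x)))"
  shows "\<exists>C\<ge>0. \<forall>t\<in>{0..T}. \<exists>D. (energy has_real_derivative D) (at t within {0..T}) \<and>
      D \<le> C * energy t - 2 * (LINT x:crd c ` E|lborel.
        inner2 (g t) (\<eta> t) (\<sigma> t) c (inv_crd c x) * sqrt (det (g t c (inv_crd c x))))"
    and "t \<in> {0..T} \<Longrightarrow> 0 \<le> energy t"
    and "t \<in> {0..T} \<Longrightarrow> energy t = 0 \<Longrightarrow> negligible (crd c ` {p \<in> E. \<eta> t c p \<noteq> 0})"
proof -
  let ?U = "crd c ` E" and ?K = "crd c ` L"
  let ?P = "\<lambda>u v t x. kernel2 (g t) c (inv_crd c x) u v"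
  let ?e = "\<lambda>u t x. \<eta> t c (inv_crd c x) $ fst u $ snd u"
  let ?s = "\<lambda>u t x. \<sigma> t c (inv_crd c x) $ fst u $ snd u"
  have K: "compact ?K" "?U \<subseteq> ?K" "?U \<in> sets borel"
    using chart_image_compact[OF c(2) E(2,4)] E chart_image_borel[OF c(2) E(1)] by auto
  have Kdom: "?K \<subseteq> crd c ` chart_dom c" using E(4) by blast
  have pd: "pos_def_matrix (g t c (inv_crd c x))" if "t \<in> {0..T}" "x \<in> ?K" for t x
    unfolding g_def using almost_hermitian_pos_def[OF ah c(1)] that E(4) T inv_crd_crd[OF c(2)] by force
  have P: "\<exists>P'. time_C1 T ?K (?P u v) P'" for u v
    unfolding g_def by (rule kernel2_time_C1[OF sm c Kdom T(2) ah])
  have e: "time_C1 T ?K (?e u) (\<lambda>t x. - ?s u t x)" for u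
    unfolding \<eta>_def by (rule flow_difference_time_C1[OF sm(1) c Kdom T der])
  have energy: "energy = (\<lambda>t. LINT x:?U|lborel. qform (\<lambda>u v. ?P u v t x) (\<lambda>u. ?e u t x))"
    unfolding energy_def inner2_kernel2 qform_def ..
  show "\<exists>C\<ge>0. \<forall>t\<in>{0..T}. \<exists>D. (energy has_real_derivative D) (at t within {0..T}) \<and>
      D \<le> C * energy t - 2 * (LINT x:crd c ` E|lborel.
        inner2 (g t) (\<eta> t) (\<sigma> t) c (inv_crd c x) * sqrt (det (g t c (inv_crd c x))))"
    unfolding energy inner2_kernel2
  proof (rule energy_derivative_le[where P="?P" and \<eta>="?e" and \<sigma>="?s", OF P _ _ e K])
    show "?P u v t x = ?P v u t x" if "t \<in> {0..T}" "x \<in> ?K" for t x u v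
      by (rule kernel2_sym, rule pd[OF that])
    show "pos_def (\<lambda>u v. ?P u v t x)" if "t \<in> {0..T}" "x \<in> ?K" for t x
      by (rule pos_def_kernel2, rule pd[OF that])
  qed
  assume t: "t \<in> {0..T}"
  let ?q = "\<lambda>x. qform (\<lambda>u v. ?P u v t x) (\<lambda>u. ?e u t x)"
  have pos: "pos_def (\<lambda>u v. ?P u v t x)" if "x \<in> ?U" for x
    using that K(2) by (intro pos_def_kernel2 pd[OF t]) blast
  show "0 \<le> energy t"
    unfolding energy by (intro set_lebesgue_integral_nonneg pos_def_nonneg pos)
  assume 0: "energy t = 0"
  have "continuous_on ?K ?q"
    unfolding qform_def
    by (intro continuous_on_sum continuous_on_mult time_C1_continuous_on(1)[OF someI_ex[OF P] t]
        time_C1_continuous_on(1)[OF e t])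
  then have "negligible {x \<in> ?U. ?q x \<noteq> 0}"
    using 0 unfolding energy
    by (intro set_integral_0_negligible set_integrable_compact_subset[OF K] pos_def_nonneg pos)
  moreover have "crd c ` {p \<in> E. \<eta> t c p \<noteq> 0} \<subseteq> {x \<in> ?U. ?q x \<noteq> 0}"
  proof (rule image_subsetI)
    fix p assume p: "p \<in> {p \<in> E. \<eta> t c p \<noteq> 0}"
    then have inv: "inv_crd c (crd c p) = p" using E inv_crd_crd[OF c(2)] by blast
    obtain i j where "\<eta> t c p $ i $ j \<noteq> 0" using p by (auto simp: vec_eq_iff)
    then have "(\<lambda>u. ?e u t (crd c p)) \<noteq> (\<lambda>_. 0)" unfolding inv by (auto simp: fun_eq_iff)
    then have "0 < ?q (crd c p)"
      using pos[of "crd c p"] p unfolding pos_def_def by blast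
    then show "crd c p \<in> {x \<in> ?U. ?q x \<noteq> 0}" using p by simp
  qed
  ultimately show "negligible (crd c ` {p \<in> E. \<eta> t c p \<noteq> 0})"
    by (rule negligible_subset)
qed

text \<open>The sign of the main term: \<open>\<langle>\<omega> - \<omega>\<^sub>0, d\<^sup>*d\<omega>\<rangle> = \<langle>d(\<omega> - \<omega>\<^sub>0), d\<omega>\<rangle> = \<parallel>d\<omega>\<parallel>\<^sup>2\<close> for closed \<open>\<omega>\<^sub>0\<close>.\<close>

lemma adjoint_closed_background_nonneg:
  fixes A :: "('m::t2_space, 'k::finite) chart set"
  assumes A: "smooth_atlas A" "compact (UNIV :: 'm set)"
    and ah: "almost_hermitian A \<omega> J" and \<omega>0: "two_form A \<omega>0"
    and closed: "\<And>c p. c \<in> A \<Longrightarrow> p \<in> chart_dom c \<Longrightarrow> ext_deriv \<omega>0 c p = 0"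
    and adj: "is_adjoint_d A (metric \<omega> J) (ext_deriv \<omega>) \<sigma>"
  shows "0 \<le> integral_vol A (metric \<omega> J) (inner2 (metric \<omega> J) (\<lambda>c p. \<omega> c p - \<omega>0 c p) \<sigma>)"
proof -
  let ?g = "metric \<omega> J" and ?\<eta> = "\<lambda>c p. \<omega> c p - \<omega>0 c p"
  have \<omega>: "two_form A \<omega>" using ah unfolding almost_hermitian_def by blast
  obtain F E where FE: "chart_partition A F E"
    and vol: "\<And>g f. integral_vol A g f =
      (\<Sum>c\<in>F. LINT x:(crd c ` E c)|lborel. f c (inv_crd c x) * sqrt (det (g c (inv_crd c x))))"
    by (rule integral_vol_partition[OF A]) (rule that)
  have "0 \<le> integral_vol A ?g (inner3 ?g (ext_deriv ?\<eta>) (ext_deriv \<omega>))"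
    unfolding vol
  proof (intro sum_nonneg set_lebesgue_integral_nonneg mult_nonneg_nonneg)
    fix c x assume "c \<in> F" "x \<in> crd c ` E c"
    moreover have "E c \<subseteq> chart_dom c" "c \<in> A" "is_chart c"
      using \<open>c \<in> F\<close> FE A(1) unfolding chart_partition_def smooth_atlas_def by blast+
    moreover obtain p where "p \<in> E c" "x = crd c p"
      using \<open>x \<in> crd c ` E c\<close> by blast
    ultimately have c: "c \<in> A" "is_chart c" "inv_crd c x \<in> chart_dom c"
      using inv_crd_crd[of c p] by auto
    have pd: "pos_def_matrix (?g c (inv_crd c x))"
      by (rule almost_hermitian_pos_def[OF ah c(1,3)])
    have "ext_deriv ?\<eta> c (inv_crd c x) = ext_deriv \<omega> c (inv_crd c x)"
      using ext_deriv_diff[OF _ _ c] \<omega> \<omega>0 closed[OF c(1,3)] unfolding two_form_def by simp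
    then have "inner3 ?g (ext_deriv ?\<eta>) (ext_deriv \<omega>) c (inv_crd c x) =
        inner3 ?g (ext_deriv \<omega>) (ext_deriv \<omega>) c (inv_crd c x)"
      by (simp only: inner3_def)
    then show "0 \<le> inner3 ?g (ext_deriv ?\<eta>) (ext_deriv \<omega>) c (inv_crd c x)"
      using inner3_nonneg[of ?g c "inv_crd c x", OF pd] by simp
    show "0 \<le> sqrt (det (?g c (inv_crd c x)))"
      using pos_def_matrix_det_pos[OF pd] by simp
  qed
  also have "\<dots> = integral_vol A ?g (inner2 ?g ?\<eta> \<sigma>)"
    using adj two_form_diff[OF A(1) \<omega> \<omega>0] unfolding is_adjoint_d_def by blast
  finally show ?thesis .
qed

text \<open>The pieces' energies add up to \<open>F\<close>, and only their sum satisfies \<open>F' \<le> C F\<close>: the adjoint relation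
  holds after integration over the whole manifold.\<close>

lemma flow_constant:
  fixes A :: "('m::t2_space, 'k::finite) chart set"
  assumes A: "smooth_atlas A" "compact (UNIV :: 'm set)"
    and T: "0 < T" "{0..T} \<subseteq> I"
    and sm: "smooth_family A I \<omega>" "smooth_family A I J"
    and ah: "\<And>t. t \<in> I \<Longrightarrow> almost_hermitian A (\<omega> t) (J t)"
    and adj: "\<And>t. t \<in> I \<Longrightarrow> is_adjoint_d A (metric (\<omega> t) (J t)) (ext_deriv (\<omega> t)) (\<sigma> t)"
    and der: "\<And>t. t \<in> I \<Longrightarrow> has_time_derivative A I \<omega> (\<lambda>c p. - \<sigma> t c p) t"
    and closed: "\<And>c p. c \<in> A \<Longrightarrow> p \<in> chart_dom c \<Longrightarrow> ext_deriv (\<omega> 0) c p = 0"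
    and c: "c \<in> A" and p: "p \<in> chart_dom c"
  shows "\<omega> T c p = \<omega> 0 c p"
proof -
  define g where "g t = metric (\<omega> t) (J t)" for t
  define \<eta> where "\<eta> t = (\<lambda>c p. \<omega> t c p - \<omega> 0 c p)" for t
  have two: "two_form A (\<omega> t)" if "t \<in> {0..T}" for t
    using ah that T(2) unfolding almost_hermitian_def by blast
  have two\<eta>: "two_form A (\<eta> T)"
    unfolding \<eta>_def using two_form_diff[OF A(1) two two] T(1) by simp
  obtain F E where FE: "chart_partition A F E"
    and vol: "\<And>g f. integral_vol A g f =
      (\<Sum>c\<in>F. LINT x:(crd c ` E c)|lborel. f c (inv_crd c x) * sqrt (det (g c (inv_crd c x))))"
    by (rule integral_vol_partition[OF A]) (rule that)
  have F: "finite F" "F \<subseteq> A" "(\<Union>c\<in>F. E c) = UNIV" using FE unfolding chart_partition_def by auto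
  define e where "e c t = (LINT x:crd c ` E c|lborel.
      inner2 (g t) (\<eta> t) (\<eta> t) c (inv_crd c x) * sqrt (det (g t c (inv_crd c x))))" for c t
  define r where "r c t = (LINT x:crd c ` E c|lborel.
      inner2 (g t) (\<eta> t) (\<sigma> t) c (inv_crd c x) * sqrt (det (g t c (inv_crd c x))))" for c t
  have chart: "(\<exists>C\<ge>0. \<forall>t\<in>{0..T}. \<exists>D. (e c has_real_derivative D) (at t within {0..T}) \<and>
        D \<le> C * e c t - 2 * r c t) \<and> (\<forall>t\<in>{0..T}. 0 \<le> e c t) \<and>
      (e c T = 0 \<longrightarrow> negligible (crd c ` {p \<in> E c. \<eta> T c p \<noteq> 0})) \<and> E c \<subseteq> chart_dom c"
    if "c \<in> F" for c
  proof -
    have cA: "c \<in> A" "is_chart c" using that F(2) A(1) unfolding smooth_atlas_def by auto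
    obtain L where L: "E c \<in> sets borel" "compact L" "E c \<subseteq> L" "L \<subseteq> chart_dom c"
      using FE \<open>c \<in> F\<close> unfolding chart_partition_def by blast
    have "e c = (\<lambda>t. LINT x:crd c ` E c|lborel.
      inner2 (g t) (\<eta> t) (\<eta> t) c (inv_crd c x) * sqrt (det (g t c (inv_crd c x))))"
      by (simp add: e_def fun_eq_iff)
    with chart_energy[OF sm cA T ah der L] T(1) L show ?thesis
      unfolding r_def g_def \<eta>_def by auto
  qed
  then have "\<forall>c\<in>F. \<exists>C. 0 \<le> C \<and> (\<forall>t\<in>{0..T}. \<exists>D. (e c has_real_derivative D) (at t within {0..T}) \<and>
      D \<le> C * e c t - 2 * r c t)" by blast
  from bchoice[OF this] obtain C where C: "\<And>c. c \<in> F \<Longrightarrow> 0 \<le> C c"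
    "\<And>c t. c \<in> F \<Longrightarrow> t \<in> {0..T} \<Longrightarrow> \<exists>D. (e c has_real_derivative D) (at t within {0..T}) \<and>
        D \<le> C c * e c t - 2 * r c t"
    by blast
  define D where "D c t = (SOME D. (e c has_real_derivative D) (at t within {0..T}) \<and>
        D \<le> C c * e c t - 2 * r c t)" for c t
  have D: "(e c has_real_derivative D c t) (at t within {0..T})" "D c t \<le> C c * e c t - 2 * r c t"
    if "c \<in> F" "t \<in> {0..T}" for c t
    using someI_ex[OF C(2)[OF that]] unfolding D_def by blast+
  have nn: "0 \<le> e c t" if "c \<in> F" "t \<in> {0..T}" for c t using chart that by blast
  have "(\<Sum>c\<in>F. e c T) \<le> 0"
  proof (rule gronwall_nonpos[where F="\<lambda>t. \<Sum>c\<in>F. e c t" and D="\<lambda>t. \<Sum>c\<in>F. D c t" and C="\<Sum>c\<in>F. C c"])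
    show "((\<lambda>t. \<Sum>c\<in>F. e c t) has_real_derivative (\<Sum>c\<in>F. D c t)) (at t within {0..T})"
      if "t \<in> {0..T}" for t
      by (rule DERIV_sum) (rule D(1)[OF _ that])
    show "(\<Sum>c\<in>F. D c t) \<le> (\<Sum>c\<in>F. C c) * (\<Sum>c\<in>F. e c t)" if t: "t \<in> {0..T}" for t
    proof -
      have "t \<in> I" "0 \<in> {0..T}" using t T by auto
      have "0 \<le> integral_vol A (metric (\<omega> t) (J t))
          (inner2 (metric (\<omega> t) (J t)) (\<lambda>c p. \<omega> t c p - \<omega> 0 c p) (\<sigma> t))"
        by (rule adjoint_closed_background_nonneg[OF A ah[OF \<open>t \<in> I\<close>] two[OF \<open>0 \<in> {0..T}\<close>]
              closed adj[OF \<open>t \<in> I\<close>]])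
      then have "0 \<le> (\<Sum>c\<in>F. r c t)"
        unfolding vol r_def g_def \<eta>_def .
      moreover have "(\<Sum>c\<in>F. D c t) \<le> (\<Sum>c\<in>F. C c * e c t) - 2 * (\<Sum>c\<in>F. r c t)"
        unfolding sum_distrib_left sum_subtractf[symmetric] by (intro sum_mono D(2) t)
      \<comment> \<open>one constant for all pieces, at the price of enlarging each \<open>C c\<close> to their sum\<close>
      moreover have "(\<Sum>c\<in>F. C c * e c t) \<le> (\<Sum>c\<in>F. (\<Sum>c\<in>F. C c) * e c t)"
        by (intro sum_mono mult_right_mono nn t member_le_sum C(1) F(1)) auto
      ultimately show ?thesis unfolding sum_distrib_left[symmetric] by linarith
    qed
    show "(\<Sum>c\<in>F. e c 0) = 0"
      by (simp add: e_def \<eta>_def inner2_def set_lebesgue_integral_def)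
    show "T \<in> {0..T}" using T(1) by simp
  qed
  moreover have "\<And>c. c \<in> F \<Longrightarrow> 0 \<le> e c T" using nn T(1) by simp
  ultimately have "\<And>c. c \<in> F \<Longrightarrow> e c T = 0"
    using sum_nonneg_eq_0_iff[OF F(1), of "\<lambda>c. e c T"] sum_nonneg[of F "\<lambda>c. e c T"]
    by (metis order_antisym)
  then have null: "negligible (crd c ` {p \<in> E c. \<eta> T c p \<noteq> 0})" "E c \<subseteq> chart_dom c" if "c \<in> F" for c
    using chart that by blast+
  \<comment> \<open>So far \<open>\<eta> T\<close> vanishes only almost everywhere on each Borel piece; continuity must do the rest.\<close>
  let ?V = "{p. \<exists>c\<in>A. p \<in> chart_dom c \<and> \<eta> T c p \<noteq> 0}"
  have "?V = {}"
  proof (rule chart_cover_null_imp_empty[OF A(1) F two_form_nonzero_open[OF A(1) two\<eta>]])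
    fix c assume cF: "c \<in> F"
    have "E c \<inter> ?V \<subseteq> {p \<in> E c. \<eta> T c p \<noteq> 0}"
      using bilinear_form_field_eq_0[of A "\<eta> T" _ c] two\<eta> null(2)[OF cF] F(2) cF
      unfolding two_form_def by blast
    then show "E c \<subseteq> chart_dom c \<and> negligible (crd c ` (E c \<inter> ?V))"
      using null[OF cF] negligible_subset[OF _ image_mono] by blast
  qed
  then have "\<eta> T c p = 0" using c p by blast
  then show ?thesis by (simp add: \<eta>_def)
qed

theorem proposition4p1:
  fixes A :: "('m::{t2_space, second_countable_topology}, 'k::finite) chart set"
    and n :: nat
    and I :: "real set"
    and \<omega> J :: "real \<Rightarrow> ('m, 'k) tensor2"
  assumes dim: "CARD('k) = 2 * n"
    and manifold: "smooth_atlas A" "compact (UNIV :: 'm set)"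
    and time: "is_interval I" "0 \<in> I" "I \<subseteq> {0..}" "I \<noteq> {0}"
    and flow: "ddRicci_flow A I \<omega> J"
    and symplectic: "\<forall>c\<in>A. \<forall>p\<in>chart_dom c. ext_deriv (\<omega> 0) c p = 0"
  shows "\<forall>t\<in>I. (\<forall>c\<in>A. \<forall>p\<in>chart_dom c. \<omega> t c p = \<omega> 0 c p) \<and>
           has_time_derivative A I J (B_endo (\<omega> 0) (J t)) t"
proof -
  have sm: "smooth_family A I \<omega>" "smooth_family A I J"
    and ah: "\<And>t. t \<in> I \<Longrightarrow> almost_hermitian A (\<omega> t) (J t)"
    using flow unfolding ddRicci_flow_def by auto
  let ?adj = "\<lambda>t \<sigma>. is_adjoint_d A (metric (\<omega> t) (J t)) (ext_deriv (\<omega> t)) \<sigma> \<and>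
      has_time_derivative A I \<omega> (\<lambda>c p. - \<sigma> c p) t \<and>
      has_time_derivative A I J (\<lambda>c p. K1 (\<omega> t) (J t) \<sigma> c p + B_endo (\<omega> t) (J t) c p) t"
  have "\<forall>t\<in>I. \<exists>\<sigma>. ?adj t \<sigma>"
    using flow unfolding ddRicci_flow_def by blast
  from bchoice[OF this] obtain \<sigma> where "\<forall>t\<in>I. ?adj t (\<sigma> t)" by blast
  then have adj: "\<And>t. t \<in> I \<Longrightarrow> is_adjoint_d A (metric (\<omega> t) (J t)) (ext_deriv (\<omega> t)) (\<sigma> t)"
    and der: "\<And>t. t \<in> I \<Longrightarrow> has_time_derivative A I \<omega> (\<lambda>c p. - \<sigma> t c p) t"
    and derJ: "\<And>t. t \<in> I \<Longrightarrow> has_time_derivative A I J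
        (\<lambda>c p. K1 (\<omega> t) (J t) (\<sigma> t) c p + B_endo (\<omega> t) (J t) c p) t"
    by blast+
  note closed = symplectic[rule_format]
  have const: "\<omega> t c p = \<omega> 0 c p" if t: "t \<in> I" and cp: "c \<in> A" "p \<in> chart_dom c" for t c p
  proof (cases "t = 0")
    case False
    then have "0 < t" using time(3) t by force
    moreover have "{0..t} \<subseteq> I"
      using mem_is_interval_1_I[OF time(1,2) t] by auto
    ultimately show ?thesis
      by (rule flow_constant[OF manifold _ _ sm ah adj der closed cp])
  qed simp
  have "has_time_derivative A I J (B_endo (\<omega> 0) (J t)) t" if t: "t \<in> I" for t
    unfolding has_time_derivative_def
  proof (intro ballI)
    fix c p assume cp: "c \<in> A" "p \<in> chart_dom c"
    have chart: "is_chart c" using manifold(1) cp(1) unfolding smooth_atlas_def by blast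
    \<comment> \<open>\<open>\<omega>\<close> is constant, and its derivative within \<open>I\<close> is unique since \<open>I\<close> is nondegenerate, so
      \<open>\<sigma> t = d\<^sup>*d\<omega>\<close> vanishes.\<close>
    have "t islimpt I"
    proof (rule connected_imp_perfect)
      show "connected I" using time(1) by (simp add: is_interval_connected_1)
      show "I \<noteq> {x}" for x using time(2,4) by blast
    qed (rule t)
    then have "at t within I \<noteq> bot" by (simp add: trivial_limit_within)
    moreover have "((\<lambda>s. \<omega> s c p) has_vector_derivative 0) (at t within I)"
      by (rule has_vector_derivative_transform[OF t const[OF _ cp] has_vector_derivative_const])
    moreover have "((\<lambda>s. \<omega> s c p) has_vector_derivative - \<sigma> t c p) (at t within I)"
      using der[OF t] cp unfolding has_time_derivative_def by blast
    ultimately have "0 = - \<sigma> t c p"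
      by (rule vector_derivative_unique_within)
    then have "\<sigma> t c p = 0" by simp
    then have "K1 (\<omega> t) (J t) (\<sigma> t) c p = 0"
      using almost_hermitian_pos_def[OF ah[OF t] cp] unfolding pos_def_matrix_def
      by (intro K1_eq_0) blast+
    moreover have "B_endo (\<omega> t) (J t) c p = B_endo (\<omega> 0) (J t) c p"
      by (rule B_endo_cong[OF chart cp(2)]) (rule const[OF t cp(1)])
    moreover have "((\<lambda>s. J s c p) has_vector_derivative
        K1 (\<omega> t) (J t) (\<sigma> t) c p + B_endo (\<omega> t) (J t) c p) (at t within I)"
      using derJ[OF t] cp unfolding has_time_derivative_def by blast
    ultimately show "((\<lambda>s. J s c p) has_vector_derivative B_endo (\<omega> 0) (J t) c p) (at t within I)"
      by simp
  qed
  then show ?thesis using const by blast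
qed

end
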